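(* Let $G$ be a free group (of arbitrary rank). Then every unconditionally closed subset of $G$ is algebraic. Therefore, the Markov and Zariski topologies of $G$ coincide: $\mathfrak{M}_G=\mathfrak{Z}_G$.
   Context: Let $G$ be a group with identity $1$. Pick $x\notin G$ and let $G*\langle x\rangle$ be the free product of $G$ with the infinite cyclic group $\langle x\rangle\cong\mathbb{Z}$ generated by $x$. For $g\in G$ let $\mathrm{ev}_g:G*\langle x\rangle\to G$ be the unique homomorphism which sends $x$ to $g$ and is the identity on $G$. For $w\in G*\langle x\rangle$ put $E_w=\{g\in G:\mathrm{ev}_g(w)=1\}$. The Zariski topology $\mathfrak{Z}_G$ of $G$ is the coarsest topology on $G$ in which all sets $E_w$, $w\in G*\langle x\rangle$, are closed. A subset of $G$ is algebraic if it is $\mathfrak{Z}_G$-closed. A subset of $G$ is unconditionally closed if it is closed in every Hausdorff group topology on $G$. The unconditionally closed subsets of $G$ are exactly the closed sets of a unique topology $\mathfrak{M}_G$ on $G$, called the Markov topology of $G$. *)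

theory Defs
  imports "HOL-Analysis.Analysis" "HOL-Algebra.Elementary_Groups"
begin

text \<open>Neither free groups nor free products are in HOL-Algebra. Both are defined here by generators
  and relations, as monoids of words over an alphabet \<open>L\<close> modulo the congruence generated by a set
  \<open>R\<close> of pairs of words; with the relations used below these monoids are groups.\<close>

inductive_set word_cong :: "'l set \<Rightarrow> ('l list \<times> 'l list) set \<Rightarrow> ('l list \<times> 'l list) set"
  for L :: "'l set" and R :: "('l list \<times> 'l list) set" where
  rel: "(u, v) \<in> R \<Longrightarrow> u \<in> lists L \<Longrightarrow> v \<in> lists L \<Longrightarrow> p \<in> lists L \<Longrightarrow> q \<in> lists L
          \<Longrightarrow> (p @ u @ q, p @ v @ q) \<in> word_cong L R"
| refl: "u \<in> lists L \<Longrightarrow> (u, u) \<in> word_cong L R"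
| sym: "(u, v) \<in> word_cong L R \<Longrightarrow> (v, u) \<in> word_cong L R"
| trans: "(u, v) \<in> word_cong L R \<Longrightarrow> (v, w) \<in> word_cong L R \<Longrightarrow> (u, w) \<in> word_cong L R"

definition word_class :: "'l set \<Rightarrow> ('l list \<times> 'l list) set \<Rightarrow> 'l list \<Rightarrow> 'l list set"
  where "word_class L R u = word_cong L R `` {u}"

definition presented_monoid :: "'l set \<Rightarrow> ('l list \<times> 'l list) set \<Rightarrow> 'l list set monoid"
  where "presented_monoid L R =
    \<lparr>carrier = lists L // word_cong L R,
     monoid.mult = (\<lambda>A B. \<Union>a\<in>A. \<Union>b\<in>B. word_class L R (a @ b)),
     one = word_class L R []\<rparr>"

text \<open>The letters \<open>(x, True)\<close> and \<open>(x, False)\<close> stand for \<open>x\<close> and its inverse.\<close>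

definition free_group :: "'x set \<Rightarrow> ('x \<times> bool) list set monoid"
  where "free_group X =
    presented_monoid (X \<times> UNIV) {([(x, b), (x, \<not> b)], []) | x b. x \<in> X}"

definition free_product_rels ::
  "('a, 'c) monoid_scheme \<Rightarrow> ('b, 'd) monoid_scheme \<Rightarrow> (('a + 'b) list \<times> ('a + 'b) list) set"
  where "free_product_rels G H =
    {([Inl \<one>\<^bsub>G\<^esub>], []), ([Inr \<one>\<^bsub>H\<^esub>], [])}
    \<union> {([Inl a, Inl b], [Inl (a \<otimes>\<^bsub>G\<^esub> b)]) | a b. a \<in> carrier G \<and> b \<in> carrier G}
    \<union> {([Inr a, Inr b], [Inr (a \<otimes>\<^bsub>H\<^esub> b)]) | a b. a \<in> carrier H \<and> b \<in> carrier H}"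

definition free_product ::
  "('a, 'c) monoid_scheme \<Rightarrow> ('b, 'd) monoid_scheme \<Rightarrow> ('a + 'b) list set monoid"
  where "free_product G H =
    presented_monoid (carrier G <+> carrier H) (free_product_rels G H)"

text \<open>\<open>G * \<langle>x\<rangle>\<close> is the free product of \<open>G\<close> with the additive group of the integers, and \<open>x\<close> is
  the generator \<open>1\<close> of the latter.\<close>

definition adjoin_var :: "('a, 'c) monoid_scheme \<Rightarrow> ('a + int) list set monoid"
  where "adjoin_var G = free_product G integer_group"

definition adjoin_const :: "('a, 'c) monoid_scheme \<Rightarrow> 'a \<Rightarrow> ('a + int) list set"
  where "adjoin_const G a =
    word_class (carrier G <+> carrier integer_group) (free_product_rels G integer_group) [Inl a]"

definition the_var :: "('a, 'c) monoid_scheme \<Rightarrow> ('a + int) list set"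
  where "the_var G =
    word_class (carrier G <+> carrier integer_group) (free_product_rels G integer_group) [Inr 1]"

text \<open>Restricting to extensional functions is what makes the homomorphism unique as a HOL function;
  see \<open>ev_unique\<close> below.\<close>

definition ev :: "('a, 'c) monoid_scheme \<Rightarrow> 'a \<Rightarrow> ('a + int) list set \<Rightarrow> 'a"
  where "ev G g = (THE h. h \<in> hom (adjoin_var G) G \<and> h \<in> extensional (carrier (adjoin_var G))
    \<and> (\<forall>a\<in>carrier G. h (adjoin_const G a) = a) \<and> h (the_var G) = g)"

definition solution_set :: "('a, 'c) monoid_scheme \<Rightarrow> ('a + int) list set \<Rightarrow> 'a set"
  where "solution_set G w = {g \<in> carrier G. ev G g w = \<one>\<^bsub>G\<^esub>}"

text \<open>The carrier is added to the subbase because for the trivial group all complements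
  \<open>carrier G - solution_set G w\<close> are empty.\<close>

definition zariski_topology :: "('a, 'c) monoid_scheme \<Rightarrow> 'a topology"
  where "zariski_topology G = topology_generated_by
    (insert (carrier G) {carrier G - solution_set G w | w. w \<in> carrier (adjoin_var G)})"

definition algebraic_subset :: "('a, 'c) monoid_scheme \<Rightarrow> 'a set \<Rightarrow> bool"
  where "algebraic_subset G A \<longleftrightarrow> closedin (zariski_topology G) A"

definition hausdorff_group_topology :: "('a, 'c) monoid_scheme \<Rightarrow> 'a topology \<Rightarrow> bool"
  where "hausdorff_group_topology G T \<longleftrightarrow>
    topspace T = carrier G \<and> Hausdorff_space T
    \<and> continuous_map (prod_topology T T) T (\<lambda>(a, b). a \<otimes>\<^bsub>G\<^esub> b)
    \<and> continuous_map T T (\<lambda>a. inv\<^bsub>G\<^esub> a)"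

definition unconditionally_closed :: "('a, 'c) monoid_scheme \<Rightarrow> 'a set \<Rightarrow> bool"
  where "unconditionally_closed G A \<longleftrightarrow>
    A \<subseteq> carrier G \<and> (\<forall>T. hausdorff_group_topology G T \<longrightarrow> closedin T A)"

definition markov_topology :: "('a, 'c) monoid_scheme \<Rightarrow> 'a topology"
  where "markov_topology G =
    topology (\<lambda>U. U \<subseteq> carrier G \<and> unconditionally_closed G (carrier G - U))"


subsection \<open>The definitions have their intended properties\<close>

lemma word_cong_lists:
  "(u, v) \<in> word_cong L R \<Longrightarrow> u \<in> lists L \<and> v \<in> lists L"
  by (induction rule: word_cong.induct) auto

lemma equiv_word_cong: "equiv (lists L) (word_cong L R)"
proof (rule equivI)
  show "word_cong L R \<subseteq> lists L \<times> lists L"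
  proof (rule subrelI)
    fix u v assume "(u, v) \<in> word_cong L R"
    from word_cong_lists[OF this] show "(u, v) \<in> lists L \<times> lists L" by blast
  qed
  show "refl_on (lists L) (word_cong L R)"
    by (rule refl_onI) (rule word_cong.refl)
  show "sym (word_cong L R)"
    by (rule symI) (rule word_cong.sym)
  show "trans (word_cong L R)"
    by (rule transI) (rule word_cong.trans)
qed

lemma word_cong_context:
  assumes "(u, v) \<in> word_cong L R" "p \<in> lists L" "q \<in> lists L"
  shows "(p @ u @ q, p @ v @ q) \<in> word_cong L R"
  using assms
proof (induction rule: word_cong.induct)
  case (rel u v p' q')
  then have "((p @ p') @ u @ (q' @ q), (p @ p') @ v @ (q' @ q)) \<in> word_cong L R"
    by (intro word_cong.rel) auto
  then show ?case by simp
next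
  case (refl u)
  then show ?case by (intro word_cong.refl) simp
next
  case (sym u v)
  then show ?case using word_cong.sym[OF sym.IH] by simp
next
  case (trans u v w)
  then show ?case by (blast intro: word_cong.trans[OF trans.IH])
qed

lemma word_cong_append:
  assumes "(u, u') \<in> word_cong L R" "(v, v') \<in> word_cong L R"
  shows "(u @ v, u' @ v') \<in> word_cong L R"
proof -
  have "(u @ v, u' @ v) \<in> word_cong L R"
    using word_cong_context[OF assms(1), of "[]" v] word_cong_lists[OF assms(2)] by auto
  moreover have "(u' @ v, u' @ v') \<in> word_cong L R"
    using word_cong_context[OF assms(2), of u' "[]"] word_cong_lists[OF assms(1)] by auto
  ultimately show ?thesis by (rule word_cong.trans)
qed

lemma word_class_eq_iff:
  assumes "u \<in> lists L" "v \<in> lists L"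
  shows "word_class L R u = word_class L R v \<longleftrightarrow> (u, v) \<in> word_cong L R"
  unfolding word_class_def using eq_equiv_class_iff[OF equiv_word_cong assms] .

lemma carrier_presented_monoid:
  "carrier (presented_monoid L R) = word_class L R ` lists L"
  by (auto simp: presented_monoid_def quotient_def word_class_def)

lemma one_presented_monoid: "\<one>\<^bsub>presented_monoid L R\<^esub> = word_class L R []"
  by (simp add: presented_monoid_def)

lemma mult_presented_monoid:
  assumes "u \<in> lists L" "v \<in> lists L"
  shows "word_class L R u \<otimes>\<^bsub>presented_monoid L R\<^esub> word_class L R v = word_class L R (u @ v)"
proof -
  have "word_class L R (a @ b) = word_class L R (u @ v)"
    if "a \<in> word_class L R u" "b \<in> word_class L R v" for a b
  proof -
    have *: "(u, a) \<in> word_cong L R" "(v, b) \<in> word_cong L R"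
      using that by (auto simp: word_class_def)
    then have "(a @ b, u @ v) \<in> word_cong L R"
      by (rule word_cong.sym[OF word_cong_append])
    moreover have "a @ b \<in> lists L" "u @ v \<in> lists L"
      using * by (auto dest: word_cong_lists)
    ultimately show ?thesis by (simp add: word_class_eq_iff)
  qed
  then have "(\<Union>a\<in>word_class L R u. \<Union>b\<in>word_class L R v. word_class L R (a @ b))
      = (\<Union>a\<in>word_class L R u. \<Union>b\<in>word_class L R v. word_class L R (u @ v))"
    by (intro SUP_cong HOL.refl)
  moreover have "u \<in> word_class L R u" "v \<in> word_class L R v"
    using assms by (auto simp: word_class_def intro: word_cong.refl)
  ultimately show ?thesis
    unfolding presented_monoid_def by auto
qed

lemma monoid_presented_monoid: "monoid (presented_monoid L R)"
proof (rule monoidI)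
  fix A B C
  assume "A \<in> carrier (presented_monoid L R)" "B \<in> carrier (presented_monoid L R)"
    "C \<in> carrier (presented_monoid L R)"
  then obtain u v w where "A = word_class L R u" "u \<in> lists L" "B = word_class L R v" "v \<in> lists L"
    "C = word_class L R w" "w \<in> lists L"
    by (auto simp: carrier_presented_monoid)
  then show "A \<otimes>\<^bsub>presented_monoid L R\<^esub> B \<in> carrier (presented_monoid L R)"
    "A \<otimes>\<^bsub>presented_monoid L R\<^esub> B \<otimes>\<^bsub>presented_monoid L R\<^esub> C
      = A \<otimes>\<^bsub>presented_monoid L R\<^esub> (B \<otimes>\<^bsub>presented_monoid L R\<^esub> C)"
    "\<one>\<^bsub>presented_monoid L R\<^esub> \<otimes>\<^bsub>presented_monoid L R\<^esub> A = A"
    "A \<otimes>\<^bsub>presented_monoid L R\<^esub> \<one>\<^bsub>presented_monoid L R\<^esub> = A"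
    by (simp_all add: carrier_presented_monoid one_presented_monoid mult_presented_monoid)
qed (simp add: carrier_presented_monoid one_presented_monoid)

lemma group_presented_monoid:
  assumes "\<And>a. a \<in> L \<Longrightarrow> \<exists>b\<in>L. ([b, a], []) \<in> word_cong L R"
  shows "group (presented_monoid L R)"
proof -
  have inv: "\<exists>v\<in>lists L. (v @ u, []) \<in> word_cong L R" if "u \<in> lists L" for u
    using that
  proof (induction u)
    case Nil
    then show ?case by (intro bexI[of _ "[]"]) (auto intro: word_cong.refl)
  next
    case (Cons a u)
    then obtain v where v: "v \<in> lists L" "(v @ u, []) \<in> word_cong L R" by auto
    obtain b where b: "b \<in> L" "([b, a], []) \<in> word_cong L R" using assms Cons.hyps by blast
    have "(v @ [b, a] @ u, v @ [] @ u) \<in> word_cong L R"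
      using b v Cons by (intro word_cong_context) auto
    then have "((v @ [b]) @ a # u, v @ u) \<in> word_cong L R" by simp
    from word_cong.trans[OF this v(2)] have "((v @ [b]) @ a # u, []) \<in> word_cong L R" .
    then show ?case using v b by (intro bexI[of _ "v @ [b]"]) auto
  qed
  interpret monoid "presented_monoid L R" by (rule monoid_presented_monoid)
  have left: "\<exists>B\<in>carrier (presented_monoid L R).
      B \<otimes>\<^bsub>presented_monoid L R\<^esub> A = \<one>\<^bsub>presented_monoid L R\<^esub>"
    if A: "A \<in> carrier (presented_monoid L R)" for A
  proof -
    obtain u where u: "u \<in> lists L" "A = word_class L R u"
      using A by (auto simp: carrier_presented_monoid)
    obtain v where v: "v \<in> lists L" "(v @ u, []) \<in> word_cong L R" using inv[OF u(1)] by auto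
    then have "word_class L R (v @ u) = word_class L R []"
      using u by (subst word_class_eq_iff) auto
    then show ?thesis
      using u v
      by (intro bexI[of _ "word_class L R v"])
         (auto simp: mult_presented_monoid one_presented_monoid carrier_presented_monoid)
  qed
  show ?thesis
    by (rule groupI[OF m_closed one_closed m_assoc l_one left])
qed

theorem group_free_group: "group (free_group X)"
  unfolding free_group_def
proof (rule group_presented_monoid)
  let ?L = "X \<times> UNIV" and ?R = "{([(x, b), (x, \<not> b)], []) | x b. x \<in> X}"
  fix a :: "'a \<times> bool" assume "a \<in> ?L"
  then obtain x b where a: "a = (x, b)" "x \<in> X" by blast
  have "([(x, \<not> b), (x, \<not> \<not> b)], []) \<in> ?R"
    using a(2) by blast
  then have "([(x, \<not> b), a], []) \<in> ?R"
    using a(1) by simp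
  from word_cong.rel[OF this, of ?L "[]" "[]"]
  have "([(x, \<not> b), a], []) \<in> word_cong ?L ?R"
    using a by simp
  moreover have "(x, \<not> b) \<in> ?L" using a(2) by simp
  ultimately show "\<exists>c\<in>?L. ([c, a], []) \<in> word_cong ?L ?R" by (rule bexI)
qed

theorem group_free_product:
  assumes "group G" "group H"
  shows "group (free_product G H)"
  unfolding free_product_def
proof (rule group_presented_monoid)
  interpret G: group G by fact
  interpret H: group H by fact
  let ?L = "carrier G <+> carrier H" and ?R = "free_product_rels G H"
  fix a assume a: "a \<in> ?L"
  show "\<exists>b\<in>?L. ([b, a], []) \<in> word_cong ?L ?R"
  proof (cases a)
    case (Inl g)
    then have g: "g \<in> carrier G" "inv\<^bsub>G\<^esub> g \<in> carrier G" using a by auto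
    have "([Inl (inv\<^bsub>G\<^esub> g), Inl g], [Inl (inv\<^bsub>G\<^esub> g \<otimes>\<^bsub>G\<^esub> g)]) \<in> ?R"
      unfolding free_product_rels_def using g by blast
    then have r: "([Inl (inv\<^bsub>G\<^esub> g), a], [Inl \<one>\<^bsub>G\<^esub>]) \<in> ?R"
      using g Inl by simp
    have mem: "Inl (inv\<^bsub>G\<^esub> g) \<in> ?L" "Inl \<one>\<^bsub>G\<^esub> \<in> ?L"
      using g by auto
    have "([Inl (inv\<^bsub>G\<^esub> g), a], [Inl \<one>\<^bsub>G\<^esub>]) \<in> word_cong ?L ?R"
      using word_cong.rel[OF r, of ?L "[]" "[]"] a mem by simp
    moreover have "([Inl \<one>\<^bsub>G\<^esub>], []) \<in> word_cong ?L ?R"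
      using word_cong.rel[of "[Inl \<one>\<^bsub>G\<^esub>]" "[]" ?R ?L "[]" "[]"] mem
      by (simp add: free_product_rels_def)
    ultimately have "([Inl (inv\<^bsub>G\<^esub> g), a], []) \<in> word_cong ?L ?R"
      by (rule word_cong.trans)
    then show ?thesis using mem(1) by (rule bexI)
  next
    case (Inr g)
    then have g: "g \<in> carrier H" "inv\<^bsub>H\<^esub> g \<in> carrier H" using a by auto
    have "([Inr (inv\<^bsub>H\<^esub> g), Inr g], [Inr (inv\<^bsub>H\<^esub> g \<otimes>\<^bsub>H\<^esub> g)]) \<in> ?R"
      unfolding free_product_rels_def using g by blast
    then have r: "([Inr (inv\<^bsub>H\<^esub> g), a], [Inr \<one>\<^bsub>H\<^esub>]) \<in> ?R"
      using g Inr by simp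
    have mem: "Inr (inv\<^bsub>H\<^esub> g) \<in> ?L" "Inr \<one>\<^bsub>H\<^esub> \<in> ?L"
      using g by auto
    have "([Inr (inv\<^bsub>H\<^esub> g), a], [Inr \<one>\<^bsub>H\<^esub>]) \<in> word_cong ?L ?R"
      using word_cong.rel[OF r, of ?L "[]" "[]"] a mem by simp
    moreover have "([Inr \<one>\<^bsub>H\<^esub>], []) \<in> word_cong ?L ?R"
      using word_cong.rel[of "[Inr \<one>\<^bsub>H\<^esub>]" "[]" ?R ?L "[]" "[]"] mem
      by (simp add: free_product_rels_def)
    ultimately have "([Inr (inv\<^bsub>H\<^esub> g), a], []) \<in> word_cong ?L ?R"
      by (rule word_cong.trans)
    then show ?thesis using mem(1) by (rule bexI)
  qed
qed

definition word_eval :: "('b, 'd) monoid_scheme \<Rightarrow> ('l \<Rightarrow> 'b) \<Rightarrow> 'l list \<Rightarrow> 'b"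
  where "word_eval K f u = foldr (\<lambda>l r. f l \<otimes>\<^bsub>K\<^esub> r) u \<one>\<^bsub>K\<^esub>"

lemma presented_monoid_lift:
  assumes "group K" and f: "\<And>l. l \<in> L \<Longrightarrow> f l \<in> carrier K"
    and R: "\<And>u v. (u, v) \<in> R \<Longrightarrow> u \<in> lists L \<Longrightarrow> v \<in> lists L \<Longrightarrow> word_eval K f u = word_eval K f v"
  shows "\<exists>!h. h \<in> hom (presented_monoid L R) K \<and> h \<in> extensional (carrier (presented_monoid L R))
    \<and> (\<forall>l\<in>L. h (word_class L R [l]) = f l)"
proof -
  interpret K: group K by fact
  let ?P = "presented_monoid L R"
  have closed: "word_eval K f u \<in> carrier K" if "u \<in> lists L" for u
    using that by (induction u) (simp_all add: word_eval_def f)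
  have append: "word_eval K f (u @ v) = word_eval K f u \<otimes>\<^bsub>K\<^esub> word_eval K f v"
    if "u \<in> lists L" "v \<in> lists L" for u v
    using that(1)
  proof (induction u)
    case Nil
    then show ?case using closed[OF that(2)] by (simp add: word_eval_def)
  next
    case (Cons l u)
    then show ?case using f[of l] closed[OF that(2)] closed[of u]
      by (simp add: word_eval_def K.m_assoc)
  qed
  have cong: "word_eval K f u = word_eval K f v" if "(u, v) \<in> word_cong L R" for u v
    using that
  proof (induction rule: word_cong.induct)
    case (rel u v p q)
    then have "u @ q \<in> lists L" "v @ q \<in> lists L" by simp_all
    then show ?case
      using rel R[OF rel(1-3)] by (simp only: append)
  qed simp_all
  define h where "h = (\<lambda>A\<in>carrier ?P. word_eval K f (SOME u. u \<in> A))"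
  have h: "h (word_class L R u) = word_eval K f u" if u: "u \<in> lists L" for u
  proof -
    have "u \<in> word_class L R u"
      unfolding word_class_def using word_cong.refl[OF u] by blast
    then have "(SOME v. v \<in> word_class L R u) \<in> word_class L R u"
      by (rule someI)
    then have "(u, SOME v. v \<in> word_class L R u) \<in> word_cong L R"
      unfolding word_class_def by blast
    from cong[OF this] show ?thesis
      using u unfolding h_def by (simp add: carrier_presented_monoid)
  qed
  show ?thesis
  proof (rule ex1I[of _ h], intro conjI ballI)
    show "h \<in> hom ?P K"
    proof (rule homI)
      fix A assume "A \<in> carrier ?P"
      then show "h A \<in> carrier K"
        unfolding carrier_presented_monoid using h closed by fastforce
    next
      fix A B assume "A \<in> carrier ?P" "B \<in> carrier ?P"
      then obtain u v where uv: "u \<in> lists L" "A = word_class L R u" "v \<in> lists L" "B = word_class L R v"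
        unfolding carrier_presented_monoid by blast
      have "u @ v \<in> lists L" using uv by simp
      then show "h (A \<otimes>\<^bsub>?P\<^esub> B) = h A \<otimes>\<^bsub>K\<^esub> h B"
        using uv(2,4) by (simp only: mult_presented_monoid[OF uv(1,3)] h uv(1,3) append)
    qed
    show "h \<in> extensional (carrier ?P)"
      by (simp add: h_def)
    fix l assume "l \<in> L"
    then show "h (word_class L R [l]) = f l"
      using h[of "[l]"] f[of l] by (simp add: word_eval_def)
  next
    fix k assume k: "k \<in> hom ?P K \<and> k \<in> extensional (carrier ?P)
      \<and> (\<forall>l\<in>L. k (word_class L R [l]) = f l)"
    have "k (word_class L R u) = word_eval K f u" if "u \<in> lists L" for u
      using that
    proof (induction u)
      case Nil
      let ?e = "word_class L R []"
      have "?e \<in> carrier ?P" unfolding carrier_presented_monoid by simp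
      moreover have "?e \<otimes>\<^bsub>?P\<^esub> ?e = ?e" using mult_presented_monoid[of "[]" L "[]" R] by simp
      ultimately have "k ?e \<in> carrier K" "k ?e \<otimes>\<^bsub>K\<^esub> k ?e = k ?e"
        using k by (auto dest: hom_in_carrier simp flip: hom_mult)
      then show ?case by (simp add: word_eval_def)
    next
      case (Cons l u)
      then have "word_class L R (l # u) = word_class L R [l] \<otimes>\<^bsub>?P\<^esub> word_class L R u"
        using mult_presented_monoid[of "[l]" L u R] by simp
      moreover have "word_class L R [l] \<in> carrier ?P" "word_class L R u \<in> carrier ?P"
        using Cons.hyps unfolding carrier_presented_monoid by auto
      ultimately have "k (word_class L R (l # u)) = k (word_class L R [l]) \<otimes>\<^bsub>K\<^esub> k (word_class L R u)"
        using k hom_mult by metis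
      then show ?case using k Cons by (simp add: word_eval_def)
    qed
    then have "k (word_class L R u) = h (word_class L R u)" if "u \<in> lists L" for u
      using that by (simp only: h)
    then have "k A = h A" if "A \<in> carrier ?P" for A
      using that unfolding carrier_presented_monoid by blast
    then show "k = h"
      using k by (intro extensionalityI[of k "carrier ?P"]) (auto simp: h_def)
  qed
qed

theorem free_group_universal:
  assumes "group K" and f: "f \<in> X \<rightarrow> carrier K"
  shows "\<exists>!h. h \<in> hom (free_group X) K \<and> h \<in> extensional (carrier (free_group X))
    \<and> (\<forall>x\<in>X. h (word_class (X \<times> UNIV) {([(x, b), (x, \<not> b)], []) | x b. x \<in> X} [(x, True)]) = f x)"
proof -
  interpret K: group K by fact
  let ?L = "X \<times> (UNIV :: bool set)" and ?R = "{([(x, b), (x, \<not> b)], []) | x b. x \<in> X}"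
  let ?f = "\<lambda>(x, b). if b then f x else inv\<^bsub>K\<^esub> f x"
  have fX: "f x \<in> carrier K" if "x \<in> X" for x using f that by blast
  have 1: "\<exists>!h. h \<in> hom (free_group X) K \<and> h \<in> extensional (carrier (free_group X))
      \<and> (\<forall>l\<in>?L. h (word_class ?L ?R [l]) = ?f l)"
    unfolding free_group_def
    by (rule presented_monoid_lift[OF assms(1)])
       (auto simp: word_eval_def fX K.r_inv K.l_inv split: if_splits)
  have iff: "(\<forall>l\<in>?L. h (word_class ?L ?R [l]) = ?f l) \<longleftrightarrow>
      (\<forall>x\<in>X. h (word_class ?L ?R [(x, True)]) = f x)" if h: "h \<in> hom (free_group X) K" for h
  proof
    assume *: "\<forall>x\<in>X. h (word_class ?L ?R [(x, True)]) = f x"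
    interpret h: group_hom "free_group X" K h
      using h by (intro group_hom.intro group_hom_axioms.intro group_free_group assms(1))
    show "\<forall>l\<in>?L. h (word_class ?L ?R [l]) = ?f l"
    proof
      fix l assume "l \<in> ?L"
      then obtain x b where l: "l = (x, b)" "x \<in> X" by blast
      let ?c = "\<lambda>b. word_class ?L ?R [(x, b)]"
      have c: "?c b \<in> carrier (free_group X)" for b
        unfolding free_group_def carrier_presented_monoid using l(2) by auto
      have "([(x, False), (x, \<not> False)], []) \<in> ?R" using l(2) by blast
      then have "([(x, False), (x, True)], []) \<in> ?R" by simp
      from word_cong.rel[OF this, of ?L "[]" "[]"]
      have "([(x, False), (x, True)], []) \<in> word_cong ?L ?R" using l(2) by simp
      then have "word_class ?L ?R ([(x, False)] @ [(x, True)]) = word_class ?L ?R []"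
        by (subst word_class_eq_iff) (use l(2) in simp_all)
      moreover have "word_class ?L ?R ([(x, False)] @ [(x, True)])
          = ?c False \<otimes>\<^bsub>free_group X\<^esub> ?c True"
        unfolding free_group_def by (rule mult_presented_monoid[symmetric]) (use l(2) in simp_all)
      ultimately have "?c False \<otimes>\<^bsub>free_group X\<^esub> ?c True = \<one>\<^bsub>free_group X\<^esub>"
        unfolding free_group_def one_presented_monoid by simp
      from arg_cong[OF this, of h] have "h (?c False) \<otimes>\<^bsub>K\<^esub> h (?c True) = \<one>\<^bsub>K\<^esub>"
        by (simp only: h.hom_mult[OF c c] h.hom_one)
      from K.inv_equality[OF this h.hom_closed[OF c] h.hom_closed[OF c]]
      have "h (?c False) = inv\<^bsub>K\<^esub> h (?c True)" ..
      then show "h (word_class ?L ?R [l]) = ?f l"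
        using * l by (cases b) simp_all
    qed
  qed auto
  from 1 show ?thesis by (simp only: iff cong: conj_cong)
qed

theorem ev_unique:
  assumes "group G" and g: "g \<in> carrier G"
  shows "\<exists>!h. h \<in> hom (adjoin_var G) G \<and> h \<in> extensional (carrier (adjoin_var G))
    \<and> (\<forall>a\<in>carrier G. h (adjoin_const G a) = a) \<and> h (the_var G) = g"
proof -
  interpret G: group G by fact
  let ?L = "carrier G <+> carrier integer_group" and ?R = "free_product_rels G integer_group"
  let ?f = "case_sum (\<lambda>a. a) (\<lambda>n::int. g [^]\<^bsub>G\<^esub> n)"
  have 1: "\<exists>!h. h \<in> hom (adjoin_var G) G \<and> h \<in> extensional (carrier (adjoin_var G))
      \<and> (\<forall>l\<in>?L. h (word_class ?L ?R [l]) = ?f l)"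
    unfolding adjoin_var_def free_product_def
    by (rule presented_monoid_lift[OF assms(1)])
       (auto simp: word_eval_def free_product_rels_def g G.int_pow_mult)
  have iff: "(\<forall>l\<in>?L. h (word_class ?L ?R [l]) = ?f l) \<longleftrightarrow>
      (\<forall>a\<in>carrier G. h (adjoin_const G a) = a) \<and> h (the_var G) = g"
    if h: "h \<in> hom (adjoin_var G) G" for h
  proof
    assume l: "\<forall>l\<in>?L. h (word_class ?L ?R [l]) = ?f l"
    have "h (adjoin_const G a) = a" if "a \<in> carrier G" for a
      using bspec[OF l, of "Inl a"] that by (simp add: adjoin_const_def InlI)
    moreover have "h (the_var G) = g"
      using bspec[OF l, of "Inr 1"] g by (simp add: the_var_def InrI)
    ultimately show "(\<forall>a\<in>carrier G. h (adjoin_const G a) = a) \<and> h (the_var G) = g" by simp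
  next
    assume *: "(\<forall>a\<in>carrier G. h (adjoin_const G a) = a) \<and> h (the_var G) = g"
    interpret h: group_hom "adjoin_var G" G h
      using h unfolding adjoin_var_def
      by (intro group_hom.intro group_hom_axioms.intro group_free_product assms(1) group_integer_group)
    let ?c = "\<lambda>n::int. word_class ?L ?R [Inr n]"
    have L: "Inr n \<in> ?L" for n :: int by auto
    have c: "?c n \<in> carrier (adjoin_var G)" for n
      unfolding adjoin_var_def free_product_def carrier_presented_monoid using L by auto
    have add: "?c (m + n) = ?c m \<otimes>\<^bsub>adjoin_var G\<^esub> ?c n" for m n
    proof -
      have "([Inr m, Inr n], [Inr (m \<otimes>\<^bsub>integer_group\<^esub> n)]) \<in> ?R"
        unfolding free_product_rels_def by auto
      then have "([Inr m, Inr n], [Inr (m + n)]) \<in> ?R" by simp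
      from word_cong.rel[OF this, of ?L "[]" "[]"]
      have "([Inr m, Inr n], [Inr (m + n)]) \<in> word_cong ?L ?R" using L by simp
      then have "word_class ?L ?R ([Inr m] @ [Inr n]) = ?c (m + n)"
        by (subst word_class_eq_iff) (use L in simp_all)
      moreover have "word_class ?L ?R ([Inr m] @ [Inr n]) = ?c m \<otimes>\<^bsub>adjoin_var G\<^esub> ?c n"
        unfolding adjoin_var_def free_product_def
        by (rule mult_presented_monoid[symmetric]) (use L in simp_all)
      ultimately show ?thesis by simp
    qed
    have "h (?c (m + n)) = h (?c m) \<otimes>\<^bsub>G\<^esub> h (?c n)" for m n
      by (simp only: add h.hom_mult[OF c c])
    then have "(\<lambda>n. h (?c n)) \<in> hom integer_group G"
      by (intro homI) (simp_all only: h.hom_closed[OF c] mult_integer_group)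
    then interpret k: group_hom integer_group G "\<lambda>n. h (?c n)"
      by (intro group_hom.intro group_hom_axioms.intro assms(1) group_integer_group)
    have "h (?c n) = g [^]\<^bsub>G\<^esub> n" for n
    proof -
      have "h (?c (1 [^]\<^bsub>integer_group\<^esub> n)) = h (?c 1) [^]\<^bsub>G\<^esub> n"
        by (rule k.hom_int_pow) simp
      then show ?thesis using * by (simp add: the_var_def)
    qed
    then show "\<forall>l\<in>?L. h (word_class ?L ?R [l]) = ?f l"
      using * by (auto simp: adjoin_const_def)
  qed
  from 1 show ?thesis by (simp only: iff cong: conj_cong)
qed

theorem topspace_zariski_topology: "topspace (zariski_topology G) = carrier G"
  unfolding zariski_topology_def topology_generated_by_topspace by auto

theorem closedin_zariski_solution_set:
  assumes "w \<in> carrier (adjoin_var G)"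
  shows "closedin (zariski_topology G) (solution_set G w)"
proof -
  have "openin (zariski_topology G) (carrier G - solution_set G w)"
    unfolding zariski_topology_def by (rule topology_generated_by_Basis) (use assms in blast)
  moreover have "solution_set G w \<subseteq> carrier G" by (auto simp: solution_set_def)
  ultimately show ?thesis by (simp add: closedin_def topspace_zariski_topology)
qed

theorem zariski_topology_coarsest:
  assumes T: "topspace T = carrier G"
    and cl: "\<And>w. w \<in> carrier (adjoin_var G) \<Longrightarrow> closedin T (solution_set G w)"
    and U: "openin (zariski_topology G) U"
  shows "openin T U"
proof -
  let ?S = "insert (carrier G) {carrier G - solution_set G w | w. w \<in> carrier (adjoin_var G)}"
  have S: "openin T V" if "V \<in> ?S" for V
    using that cl T openin_topspace[of T] by (auto simp: closedin_def)
  have "generate_topology_on ?S U"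
    using U unfolding zariski_topology_def by (rule openin_topology_generated_by)
  then show ?thesis
    by (induction rule: generate_topology_on.induct) (use S in auto)
qed

lemma unconditionally_closed_Diff:
  assumes "U \<subseteq> carrier G"
  shows "unconditionally_closed G (carrier G - U) \<longleftrightarrow>
    (\<forall>T. hausdorff_group_topology G T \<longrightarrow> openin T U)"
  using assms by (auto simp: unconditionally_closed_def hausdorff_group_topology_def openin_closedin_eq)

lemma openin_markov_topology:
  "openin (markov_topology G) U \<longleftrightarrow> U \<subseteq> carrier G \<and> unconditionally_closed G (carrier G - U)"
proof -
  have "istopology (\<lambda>U. U \<subseteq> carrier G \<and> (\<forall>T. hausdorff_group_topology G T \<longrightarrow> openin T U))"
    unfolding istopology_def
  proof (intro conjI allI impI)
    fix U V T
    assume "U \<subseteq> carrier G \<and> (\<forall>T. hausdorff_group_topology G T \<longrightarrow> openin T U)"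
      and "V \<subseteq> carrier G \<and> (\<forall>T. hausdorff_group_topology G T \<longrightarrow> openin T V)"
    then show "U \<inter> V \<subseteq> carrier G"
      and "hausdorff_group_topology G T \<Longrightarrow> openin T (U \<inter> V)"
      by auto
  next
    fix \<U> T
    assume "\<forall>U\<in>\<U>. U \<subseteq> carrier G \<and> (\<forall>T. hausdorff_group_topology G T \<longrightarrow> openin T U)"
    then show "\<Union>\<U> \<subseteq> carrier G"
      and "hausdorff_group_topology G T \<Longrightarrow> openin T (\<Union>\<U>)"
      by auto
  qed
  then have "istopology (\<lambda>U. U \<subseteq> carrier G \<and> unconditionally_closed G (carrier G - U))"
    by (simp add: unconditionally_closed_Diff cong: conj_cong)
  then show ?thesis
    by (simp add: markov_topology_def)
qed

theorem topspace_markov_topology: "topspace (markov_topology G) = carrier G"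
proof (rule subset_antisym)
  show "topspace (markov_topology G) \<subseteq> carrier G"
    using openin_topspace[of "markov_topology G"] unfolding openin_markov_topology by blast
  have "openin (markov_topology G) (carrier G)"
    by (simp add: openin_markov_topology unconditionally_closed_def)
  then show "carrier G \<subseteq> topspace (markov_topology G)"
    by (rule openin_subset)
qed

theorem closedin_markov_topology:
  "closedin (markov_topology G) A \<longleftrightarrow> unconditionally_closed G A"
proof -
  have "A \<subseteq> carrier G \<Longrightarrow> carrier G - (carrier G - A) = A" by blast
  then show ?thesis
    by (auto simp: closedin_def topspace_markov_topology openin_markov_topology
        unconditionally_closed_def)
qed

end

theory Submission
  imports Defs
begin

text \<open>
  Algebraic sets are closed in every Hausdorff group topology because evaluation maps are
  continuous. For the converse let \<open>A\<close> be a subset of a free group \<open>G\<close> with basis \<open>e ` X\<close> and let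
  \<open>b\<close> lie in the Zariski closure of \<open>A\<close> but not in \<open>A\<close>. It suffices to find one Hausdorff group
  topology on \<open>G\<close> in which \<open>b\<close> is adherent to \<open>A\<close>. After a left translation \<open>b\<close> is the identity,
  and the Zariski adherence of the identity says that any finitely many one-variable words with
  coefficients in \<open>G\<close> whose values at the identity are nontrivial are simultaneously nontrivial at
  some point of \<open>A\<close> (\<open>one_adherent\<close>).

  For a countable group \<open>H\<close> in place of \<open>G\<close> this is Markov's theorem. One
  picks \<open>a\<^sub>0, a\<^sub>1, \<dots>\<close> in \<open>A\<close> and lets neighbourhoods \<open>U\<^sub>n\<close> of the identity be the smallest sets
  that contain \<open>a\<^sub>n\<close> and everything forced by \<open>U\<^sub>n\<^sub>+\<^sub>1\<close> through the axioms of a group topology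
  (\<open>small\<close>). Such \<open>U\<^sub>n\<close> always define a group topology in which the sequence converges to
  the identity. Only the Hausdorff property is in question, and it is ensured by keeping the \<open>j\<close>-th
  element of \<open>H\<close>, unless it is the identity, out of \<open>U\<^sub>j\<^sub>+\<^sub>1\<close>. At the
  stage where \<open>a\<^sub>N\<close> is chosen, this amounts to finitely many word inequations which hold if the identity is put for \<open>a\<^sub>N\<close>, so \<open>one_adherent\<close> provides
  a suitable element of \<open>A\<close> (\<open>exists_small_sequence\<close>).

  Two observations reduce an uncountable free group to this case. By a
  closing-off argument of Loewenheim-Skolem type there is a countable set \<open>Y\<close> of basis elements,
  infinite or equal to the whole basis, such that the identity is already adherent, for words over
  the free factor \<open>H\<close> generated by \<open>Y\<close>, to \<open>A \<inter> H\<close> (\<open>countable_adherent_factor\<close>). Moreover, the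
  retractions of \<open>G\<close> onto \<open>H\<close> separate the points of \<open>G\<close>: an element involves only finitely many
  basis elements, and those outside \<open>Y\<close> can be renamed injectively to unused members of \<open>Y\<close>
  (\<open>separating_retraction\<close>). Hence the initial topology on \<open>G\<close> with respect to all these retractions
  and Markov's topology on \<open>H\<close> is a Hausdorff group topology; as the retractions fix \<open>A \<inter> H\<close>
  pointwise, the identity remains adherent to it (\<open>topology_with_adherent_set\<close>).
\<close>

section \<open>Countable closures\<close>

text \<open>This single closing-off principle serves for generated subgroups and sets of words as well as
  for the Loewenheim-Skolem argument. Restricting \<open>K\<close> to finite sets makes countably many rounds
  enough: a finite subset of the union is already contained in one round.\<close>
lemma countable_closure:
  fixes K :: "'b set \<Rightarrow> 'b set"
  assumes "countable C" and K: "\<And>F. finite F \<Longrightarrow> countable (K F)"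
  obtains D where "countable D" "C \<subseteq> D" "\<And>F. finite F \<Longrightarrow> F \<subseteq> D \<Longrightarrow> K F \<subseteq> D"
proof -
  define step where "step S = S \<union> (\<Union>F\<in>{F. F \<subseteq> S \<and> finite F}. K F)" for S
  define S where "S n = (step ^^ n) C" for n :: nat
  have S_Suc: "S (Suc n) = step (S n)" for n by (simp add: S_def)
  have count: "countable (S n)" for n
  proof (induction n)
    case 0
    show ?case using assms(1) by (simp add: S_def)
  next
    case (Suc n)
    have "countable {F. F \<subseteq> S n \<and> finite F}"
      using countable_Collect_finite_subset[OF Suc.IH] by (simp add: conj_commute)
    then show ?case using Suc.IH K unfolding S_Suc step_def by auto
  qed
  have "mono S" by (rule mono_iff_le_Suc[THEN iffD2]) (auto simp: S_Suc step_def)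
  have "K F \<subseteq> (\<Union>n. S n)" if F: "finite F" "F \<subseteq> (\<Union>n. S n)" for F
  proof -
    have "\<exists>n. F \<subseteq> S n"
      using F
    proof (induction F)
      case (insert x F)
      then obtain n m where "F \<subseteq> S n" "x \<in> S m" by auto
      then have "insert x F \<subseteq> S (max n m)"
        using monoD[OF \<open>mono S\<close>, of n "max n m"] monoD[OF \<open>mono S\<close>, of m "max n m"] by auto
      then show ?case ..
    qed simp
    then obtain n where "F \<subseteq> S n" ..
    then have "K F \<subseteq> S (Suc n)" using F(1) by (auto simp: S_Suc step_def)
    then show ?thesis by blast
  qed
  moreover have "C \<subseteq> (\<Union>n. S n)" using UN_upper[of 0 UNIV S] by (simp add: S_def)
  ultimately show ?thesis using that[of "\<Union>n. S n"] count by auto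
qed

section \<open>Word maps\<close>

text \<open>Working with the functions that words in one variable induce on \<open>G\<close>, instead of with elements
  of the free product, allows words to be built by induction without any normal form. Outside the
  carrier the values of these functions are meaningless.\<close>
inductive_set word_maps :: "('a, 'c) monoid_scheme \<Rightarrow> 'a set \<Rightarrow> ('a \<Rightarrow> 'a) set"
  for G :: "('a, 'c) monoid_scheme" and C :: "'a set" where
  const: "c \<in> C \<Longrightarrow> (\<lambda>_. c) \<in> word_maps G C"
| var: "(\<lambda>t. t) \<in> word_maps G C"
| mult: "p \<in> word_maps G C \<Longrightarrow> q \<in> word_maps G C \<Longrightarrow> (\<lambda>t. p t \<otimes>\<^bsub>G\<^esub> q t) \<in> word_maps G C"
| inv: "p \<in> word_maps G C \<Longrightarrow> (\<lambda>t. inv\<^bsub>G\<^esub> (p t)) \<in> word_maps G C"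

text \<open>The complements of solution sets form a subbase, so for \<open>C = carrier G\<close> this says that the
  identity lies in the Zariski closure of \<open>A\<close>. A smaller coefficient set \<open>C\<close> is needed for the
  passage to a countable subgroup.\<close>
definition one_adherent :: "('a, 'c) monoid_scheme \<Rightarrow> 'a set \<Rightarrow> 'a set \<Rightarrow> bool"
  where "one_adherent G C A \<longleftrightarrow> (\<forall>W. finite W \<longrightarrow> W \<subseteq> word_maps G C
    \<longrightarrow> (\<forall>p\<in>W. p \<one>\<^bsub>G\<^esub> \<noteq> \<one>\<^bsub>G\<^esub>) \<longrightarrow> (\<exists>a\<in>A. \<forall>p\<in>W. p a \<noteq> \<one>\<^bsub>G\<^esub>))"

lemma one_adherentD:
  assumes "one_adherent G C A" "finite W" "W \<subseteq> word_maps G C" "\<forall>p\<in>W. p \<one>\<^bsub>G\<^esub> \<noteq> \<one>\<^bsub>G\<^esub>"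
  obtains a where "a \<in> A" "\<forall>p\<in>W. p a \<noteq> \<one>\<^bsub>G\<^esub>"
  using assms unfolding one_adherent_def by metis

lemma word_maps_mono: "C \<subseteq> D \<Longrightarrow> word_maps G C \<subseteq> word_maps G D"
proof
  fix p assume "C \<subseteq> D" "p \<in> word_maps G C"
  from this(2,1) show "p \<in> word_maps G D"
  proof induction
    case (const c)
    then show ?case by (intro word_maps.const) blast
  next
    case var
    show ?case by (rule word_maps.var)
  next
    case (mult p q)
    then show ?case by (intro word_maps.mult)
  next
    case (inv p)
    then show ?case by (intro word_maps.inv)
  qed
qed

lemma word_maps_finitary:
  assumes "finite W" "W \<subseteq> word_maps G C"
  obtains F where "finite F" "F \<subseteq> C" "W \<subseteq> word_maps G F"
proof -
  have union: "\<exists>F. finite F \<and> F \<subseteq> C \<and> p \<in> word_maps G F \<and> q \<in> word_maps G F"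
    if "\<exists>F. finite F \<and> F \<subseteq> C \<and> p \<in> word_maps G F"
      and "\<exists>F. finite F \<and> F \<subseteq> C \<and> q \<in> word_maps G F" for p q
  proof -
    from that(1) obtain F where F: "finite F \<and> F \<subseteq> C \<and> p \<in> word_maps G F" ..
    from that(2) obtain F' where F': "finite F' \<and> F' \<subseteq> C \<and> q \<in> word_maps G F'" ..
    have "p \<in> word_maps G (F \<union> F')" "q \<in> word_maps G (F \<union> F')"
      using F F' word_maps_mono[of F "F \<union> F'" G] word_maps_mono[of F' "F \<union> F'" G]
      by (simp_all add: subset_iff)
    then have "finite (F \<union> F') \<and> F \<union> F' \<subseteq> C \<and> p \<in> word_maps G (F \<union> F') \<and> q \<in> word_maps G (F \<union> F')"
      using F F' by simp
    then show ?thesis ..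
  qed
  have "\<exists>F. finite F \<and> F \<subseteq> C \<and> p \<in> word_maps G F" if "p \<in> word_maps G C" for p
    using that
  proof induction
    case (const c)
    then have "finite {c} \<and> {c} \<subseteq> C \<and> (\<lambda>_. c) \<in> word_maps G {c}"
      by (simp add: word_maps.const)
    then show ?case ..
  next
    case var
    have "finite {} \<and> {} \<subseteq> C \<and> (\<lambda>t. t) \<in> word_maps G {}"
      by (simp add: word_maps.var)
    then show ?case ..
  next
    case (mult p q)
    then obtain F where "finite F" "F \<subseteq> C" "p \<in> word_maps G F" "q \<in> word_maps G F"
      using union[of p q] by blast
    then have "finite F \<and> F \<subseteq> C \<and> (\<lambda>t. p t \<otimes>\<^bsub>G\<^esub> q t) \<in> word_maps G F"
      by (simp add: word_maps.mult)
    then show ?case ..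
  next
    case (inv p)
    then obtain F where "finite F" "F \<subseteq> C" "p \<in> word_maps G F" by blast
    then have "finite F \<and> F \<subseteq> C \<and> (\<lambda>t. inv\<^bsub>G\<^esub> (p t)) \<in> word_maps G F"
      by (simp add: word_maps.inv)
    then show ?case ..
  qed
  then obtain F where F: "\<forall>p\<in>W. finite (F p) \<and> F p \<subseteq> C \<and> p \<in> word_maps G (F p)"
    using assms(2) bchoice[of W "\<lambda>p F. finite F \<and> F \<subseteq> C \<and> p \<in> word_maps G F"] by blast
  have "W \<subseteq> word_maps G (\<Union>p\<in>W. F p)"
  proof
    fix p assume "p \<in> W"
    then show "p \<in> word_maps G (\<Union>p\<in>W. F p)"
      using F word_maps_mono[of "F p" "\<Union>p\<in>W. F p" G] by blast
  qed
  moreover have "finite (\<Union>p\<in>W. F p)" "(\<Union>p\<in>W. F p) \<subseteq> C" using F assms(1) by auto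
  ultimately show ?thesis using that by blast
qed

lemma countable_word_maps:
  assumes "countable C"
  shows "countable (word_maps G C)"
proof -
  define K where "K F = (\<lambda>(p, q) t. p t \<otimes>\<^bsub>G\<^esub> q t) ` (F \<times> F) \<union> (\<lambda>p t. inv\<^bsub>G\<^esub> (p t)) ` F"
    for F :: "('a \<Rightarrow> 'a) set"
  obtain D where D: "countable D" "insert (\<lambda>t. t) ((\<lambda>c _. c) ` C) \<subseteq> D"
    "\<And>F. finite F \<Longrightarrow> F \<subseteq> D \<Longrightarrow> K F \<subseteq> D"
    by (rule countable_closure[of "insert (\<lambda>t. t) ((\<lambda>c _. c) ` C)" K])
       (use assms in \<open>auto simp: K_def intro: countable_finite\<close>)
  have "word_maps G C \<subseteq> D"
  proof
    fix p assume "p \<in> word_maps G C"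
    then show "p \<in> D"
    proof induction
    case (const c)
    then have "(\<lambda>_. c) \<in> (\<lambda>c _. c) ` C" by (rule imageI)
    with D(2)[unfolded insert_subset, THEN conjunct2] show ?case by (rule subsetD)
  next
    case var
    show ?case using D(2) by simp
  next
    case (mult p q)
    then show ?case using D(3)[of "{p, q}"] by (simp add: K_def)
  next
    case (inv p)
    then show ?case using D(3)[of "{p}"] by (simp add: K_def)
    qed
  qed
  then show ?thesis by (rule countable_subset[OF _ D(1)])
qed

lemma (in group) word_maps_closed:
  assumes "p \<in> word_maps G C" "subgroup H G" "C \<subseteq> H" "t \<in> H"
  shows "p t \<in> H"
  using assms(1)
proof induction
  case (mult p q)
  then show ?case using subgroup.m_closed[OF assms(2)] by simp
next
  case (inv p)
  then show ?case using subgroup.m_inv_closed[OF assms(2)] by simp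
qed (use assms in auto)

section \<open>Word maps are the evaluations of elements of the free product with a variable\<close>

lemma ev_properties:
  assumes "group G" "g \<in> carrier G"
  shows "ev G g \<in> hom (adjoin_var G) G"
    and "a \<in> carrier G \<Longrightarrow> ev G g (adjoin_const G a) = a"
    and "ev G g (the_var G) = g"
  using theI'[OF ev_unique[OF assms]] unfolding ev_def by auto

lemma group_adjoin_var: "group G \<Longrightarrow> group (adjoin_var G)"
  unfolding adjoin_var_def by (intro group_free_product group_integer_group)

text \<open>The value of \<open>ev\<close> is specified only on the constants and on the variable. Its value on the
  power of the variable that a letter \<open>Inr n\<close> denotes follows from uniqueness: the
  homomorphism that is prescribed on all letters satisfies the specification of \<open>ev\<close>.\<close>
lemma ev_letter:
  assumes "group G" "g \<in> carrier G" and l: "l \<in> carrier G <+> carrier integer_group"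
  shows "ev G g (word_class (carrier G <+> carrier integer_group)
      (free_product_rels G integer_group) [l]) = case_sum (\<lambda>a. a) (\<lambda>n::int. g [^]\<^bsub>G\<^esub> n) l"
proof -
  interpret G: group G by fact
  let ?L = "carrier G <+> carrier integer_group" and ?R = "free_product_rels G integer_group"
  let ?f = "case_sum (\<lambda>a. a) (\<lambda>n::int. g [^]\<^bsub>G\<^esub> n)"
  have "\<exists>!h. h \<in> hom (adjoin_var G) G \<and> h \<in> extensional (carrier (adjoin_var G))
      \<and> (\<forall>l\<in>?L. h (word_class ?L ?R [l]) = ?f l)"
    unfolding adjoin_var_def free_product_def
    by (rule presented_monoid_lift[OF assms(1)])
       (auto simp: word_eval_def free_product_rels_def assms(2) G.int_pow_mult)
  then obtain h where h: "h \<in> hom (adjoin_var G) G" "h \<in> extensional (carrier (adjoin_var G))"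
    "\<And>l. l \<in> ?L \<Longrightarrow> h (word_class ?L ?R [l]) = ?f l"
    by blast
  have "h (adjoin_const G a) = a" if "a \<in> carrier G" for a
    using h(3)[of "Inl a"] that by (simp add: adjoin_const_def InlI)
  moreover have "h (the_var G) = g"
    using h(3)[of "Inr 1"] assms(2) by (simp add: the_var_def InrI)
  ultimately have "ev G g = h"
    unfolding ev_def by (intro the1_equality[OF ev_unique[OF assms(1,2)]]) (use h in auto)
  then show ?thesis using h(3)[OF l] by simp
qed

lemma word_map_is_evaluation:
  assumes "group G" "p \<in> word_maps G (carrier G)"
  shows "\<exists>w\<in>carrier (adjoin_var G). \<forall>g\<in>carrier G. ev G g w = p g"
  using assms(2)
proof induction
  case (const c)
  then have "adjoin_const G c \<in> carrier (adjoin_var G)"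
    by (auto simp: adjoin_const_def adjoin_var_def free_product_def carrier_presented_monoid)
  then show ?case using ev_properties(2)[OF assms(1)] const by blast
next
  case var
  have "the_var G \<in> carrier (adjoin_var G)"
    unfolding the_var_def adjoin_var_def free_product_def carrier_presented_monoid
    by (intro imageI) (simp add: InrI)
  then show ?case using ev_properties(3)[OF assms(1)] by blast
next
  case (mult p q)
  then obtain v w where "v \<in> carrier (adjoin_var G)" "\<forall>g\<in>carrier G. ev G g v = p g"
    "w \<in> carrier (adjoin_var G)" "\<forall>g\<in>carrier G. ev G g w = q g" by blast
  then show ?case
    using hom_mult[OF ev_properties(1)[OF assms(1)]] group_adjoin_var[OF assms(1)]
    by (intro bexI[of _ "v \<otimes>\<^bsub>adjoin_var G\<^esub> w"])
       (auto intro: monoid.m_closed simp: group.is_monoid)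
next
  case (inv p)
  then obtain v where v: "v \<in> carrier (adjoin_var G)" "\<forall>g\<in>carrier G. ev G g v = p g" by blast
  have "ev G g (inv\<^bsub>adjoin_var G\<^esub> v) = inv\<^bsub>G\<^esub> p g" if "g \<in> carrier G" for g
    using group_hom.hom_inv[of "adjoin_var G" G "ev G g" v] v that
      ev_properties(1)[OF assms(1) that] group_adjoin_var[OF assms(1)] assms(1)
    by (simp add: group_hom_def group_hom_axioms_def)
  then show ?case
    using v group_adjoin_var[OF assms(1)]
    by (intro bexI[of _ "inv\<^bsub>adjoin_var G\<^esub> v"]) (auto simp: group.inv_closed)
qed

lemma (in group) int_pow_word_map:
  "\<exists>p\<in>word_maps G (carrier G). \<forall>g\<in>carrier G. p g = g [^] (n::int)"
proof -
  have nat: "\<exists>p\<in>word_maps G (carrier G). \<forall>g\<in>carrier G. p g = g [^] (k::nat)" for k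
  proof (induction k)
    case 0
    show ?case by (intro bexI[of _ "\<lambda>_. \<one>"] word_maps.const) auto
  next
    case (Suc k)
    then obtain p where "p \<in> word_maps G (carrier G)" "\<forall>g\<in>carrier G. p g = g [^] k" by blast
    then show ?case
      by (intro bexI[of _ "\<lambda>t. p t \<otimes> t"] word_maps.mult word_maps.var) auto
  qed
  obtain p where p: "p \<in> word_maps G (carrier G)" "\<forall>g\<in>carrier G. p g = g [^] nat \<bar>n\<bar>"
    using nat by blast
  show ?thesis
  proof (cases "n \<ge> 0")
    case True
    then have "\<forall>g\<in>carrier G. p g = g [^] n"
      using p(2) by (metis abs_of_nonneg int_pow_int nat_0_le)
    then show ?thesis using p(1) by blast
  next
    case False
    then have n: "\<bar>n\<bar> = - n" "n < 0" by simp_all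
    have "\<forall>g\<in>carrier G. inv (p g) = g [^] n"
    proof
      fix g assume "g \<in> carrier G"
      then have "p g = g [^] nat (- n)" using p(2) n(1) by simp
      then show "inv (p g) = g [^] n" using n(2) by (simp only: int_pow_def2 if_True)
    qed
    then show ?thesis by (rule bexI[OF _ word_maps.inv[OF p(1)]])
  qed
qed

lemma evaluation_is_word_map:
  assumes "group G" "w \<in> carrier (adjoin_var G)"
  shows "\<exists>p\<in>word_maps G (carrier G). \<forall>g\<in>carrier G. ev G g w = p g"
proof -
  interpret G: group G by fact
  let ?L = "carrier G <+> carrier integer_group" and ?R = "free_product_rels G integer_group"
  have *: "\<exists>p\<in>word_maps G (carrier G). \<forall>g\<in>carrier G. ev G g (word_class ?L ?R u) = p g"
    if "u \<in> lists ?L" for u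
    using that
  proof (induction u)
    case Nil
    have "ev G g (word_class ?L ?R []) = \<one>\<^bsub>G\<^esub>" if "g \<in> carrier G" for g
      using hom_one[OF ev_properties(1)[OF assms(1) that] group_adjoin_var[OF assms(1)] assms(1)]
      by (simp add: adjoin_var_def free_product_def one_presented_monoid)
    then show ?case by (intro bexI[of _ "\<lambda>_. \<one>\<^bsub>G\<^esub>"] word_maps.const) auto
  next
    case (Cons l u)
    then obtain p where p: "p \<in> word_maps G (carrier G)"
      "\<forall>g\<in>carrier G. ev G g (word_class ?L ?R u) = p g" by blast
    have "\<exists>q\<in>word_maps G (carrier G). \<forall>g\<in>carrier G. ev G g (word_class ?L ?R [l]) = q g"
    proof (cases l)
      case (Inl a)
      then show ?thesis
        using Cons.hyps ev_letter[OF assms(1) _ Cons.hyps(1)]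
        by (intro bexI[of _ "\<lambda>_. a"] word_maps.const) auto
    next
      case (Inr n)
      then have "ev G g (word_class ?L ?R [l]) = g [^]\<^bsub>G\<^esub> n" if "g \<in> carrier G" for g
        using ev_letter[OF assms(1) that Cons.hyps(1)] by simp
      moreover obtain q where "q \<in> word_maps G (carrier G)" "\<forall>g\<in>carrier G. q g = g [^]\<^bsub>G\<^esub> n"
        using G.int_pow_word_map[of n] by blast
      ultimately show ?thesis by (intro bexI[of _ q]) simp_all
    qed
    then obtain q where q: "q \<in> word_maps G (carrier G)"
      "\<forall>g\<in>carrier G. ev G g (word_class ?L ?R [l]) = q g" by blast
    have mult: "word_class ?L ?R (l # u) = word_class ?L ?R [l] \<otimes>\<^bsub>adjoin_var G\<^esub> word_class ?L ?R u"
      using mult_presented_monoid[of "[l]" ?L u ?R] Cons.hyps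
      by (simp add: adjoin_var_def free_product_def)
    have cl: "word_class ?L ?R [l] \<in> carrier (adjoin_var G)"
      "word_class ?L ?R u \<in> carrier (adjoin_var G)"
      using Cons.hyps
      by (auto simp: adjoin_var_def free_product_def carrier_presented_monoid)
    have "\<forall>g\<in>carrier G. ev G g (word_class ?L ?R (l # u)) = q g \<otimes>\<^bsub>G\<^esub> p g"
      unfolding mult using p(2) q(2) hom_mult[OF ev_properties(1)[OF assms(1)] cl] by simp
    then show ?case by (rule bexI[OF _ word_maps.mult[OF q(1) p(1)]])
  qed
  show ?thesis
    using assms(2) *
    unfolding adjoin_var_def free_product_def carrier_presented_monoid by blast
qed

section \<open>Algebraic sets are unconditionally closed\<close>

lemma (in group) continuous_word_map:
  assumes T: "hausdorff_group_topology G T" and "p \<in> word_maps G (carrier G)"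
  shows "continuous_map T T p"
  using assms(2)
proof induction
  case (const c)
  then show ?case using T by (simp add: hausdorff_group_topology_def)
next
  case var
  show ?case by simp
next
  case (mult p q)
  then have "continuous_map T (prod_topology T T) (\<lambda>t. (p t, q t))"
    by (simp add: continuous_map_pairedI)
  then show ?case
    using T continuous_map_compose[of T "prod_topology T T" "\<lambda>t. (p t, q t)" T "\<lambda>(a, b). a \<otimes> b"]
    by (simp add: hausdorff_group_topology_def o_def)
next
  case (inv p)
  then show ?case
    using T continuous_map_compose[of T T p T "\<lambda>a. inv a"]
    by (simp add: hausdorff_group_topology_def o_def)
qed

lemma solution_set_closed:
  assumes "group G" and T: "hausdorff_group_topology G T" and "w \<in> carrier (adjoin_var G)"
  shows "closedin T (solution_set G w)"
proof -
  interpret group G by fact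
  obtain p where p: "p \<in> word_maps G (carrier G)" "\<forall>g\<in>carrier G. ev G g w = p g"
    using evaluation_is_word_map[OF assms(1,3)] by blast
  have top: "topspace T = carrier G" "Hausdorff_space T"
    using T by (auto simp: hausdorff_group_topology_def)
  have "closedin T {\<one>\<^bsub>G\<^esub>}"
    using top by (simp add: closedin_Hausdorff_singleton)
  then have "closedin T {g \<in> topspace T. p g \<in> {\<one>\<^bsub>G\<^esub>}}"
    by (rule closedin_continuous_map_preimage[OF continuous_word_map[OF T p(1)]])
  then show ?thesis using p(2) top(1) by (simp add: solution_set_def cong: conj_cong)
qed

section \<open>Group topologies from neighbourhood bases\<close>

text \<open>The members of \<open>\<N>\<close> need not be open in the topology that they define. This matters
  because the sets to which the locale is applied are generated by closure rules and
  are not open in any evident way.\<close>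
locale identity_nbhd_base = group G for G (structure) +
  fixes \<N> :: "'a set set"
  assumes nonempty: "\<N> \<noteq> {}"
    and subset_carrier: "U \<in> \<N> \<Longrightarrow> U \<subseteq> carrier G"
    and one_mem: "U \<in> \<N> \<Longrightarrow> \<one> \<in> U"
    and directed: "U \<in> \<N> \<Longrightarrow> V \<in> \<N> \<Longrightarrow> \<exists>W\<in>\<N>. W \<subseteq> U \<inter> V"
    and quotients: "U \<in> \<N> \<Longrightarrow> \<exists>V\<in>\<N>. \<forall>x\<in>V. \<forall>y\<in>V. x \<otimes> inv y \<in> U"
    and conjugates: "U \<in> \<N> \<Longrightarrow> g \<in> carrier G \<Longrightarrow> \<exists>V\<in>\<N>. \<forall>x\<in>V. g \<otimes> x \<otimes> inv g \<in> U"
    and separating: "x \<in> carrier G \<Longrightarrow> x \<noteq> \<one> \<Longrightarrow> \<exists>U\<in>\<N>. x \<notin> U"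
begin

definition T :: "'a topology" where
  "T = topology (\<lambda>S. S \<subseteq> carrier G \<and> (\<forall>x\<in>S. \<exists>U\<in>\<N>. \<forall>u\<in>U. x \<otimes> u \<in> S))"

lemma openin_T:
  "openin T S \<longleftrightarrow> S \<subseteq> carrier G \<and> (\<forall>x\<in>S. \<exists>U\<in>\<N>. \<forall>u\<in>U. x \<otimes> u \<in> S)"
proof -
  have "istopology (\<lambda>S. S \<subseteq> carrier G \<and> (\<forall>x\<in>S. \<exists>U\<in>\<N>. \<forall>u\<in>U. x \<otimes> u \<in> S))"
    unfolding istopology_def
  proof (intro conjI allI impI)
    fix S S'
    assume S: "S \<subseteq> carrier G \<and> (\<forall>x\<in>S. \<exists>U\<in>\<N>. \<forall>u\<in>U. x \<otimes> u \<in> S)"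
      and S': "S' \<subseteq> carrier G \<and> (\<forall>x\<in>S'. \<exists>U\<in>\<N>. \<forall>u\<in>U. x \<otimes> u \<in> S')"
    show "S \<inter> S' \<subseteq> carrier G" using S by blast
    show "\<forall>x\<in>S \<inter> S'. \<exists>U\<in>\<N>. \<forall>u\<in>U. x \<otimes> u \<in> S \<inter> S'"
    proof
      fix x assume x: "x \<in> S \<inter> S'"
      then obtain U where U: "U \<in> \<N>" "\<forall>u\<in>U. x \<otimes> u \<in> S" using S by blast
      obtain V where V: "V \<in> \<N>" "\<forall>u\<in>V. x \<otimes> u \<in> S'" using S' x by blast
      obtain W where "W \<in> \<N>" "W \<subseteq> U \<inter> V" using directed[OF U(1) V(1)] by blast
      then show "\<exists>U\<in>\<N>. \<forall>u\<in>U. x \<otimes> u \<in> S \<inter> S'" using U(2) V(2) by blast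
    qed
  next
    fix \<S>
    assume \<S>: "\<forall>S\<in>\<S>. S \<subseteq> carrier G \<and> (\<forall>x\<in>S. \<exists>U\<in>\<N>. \<forall>u\<in>U. x \<otimes> u \<in> S)"
    then show "\<Union>\<S> \<subseteq> carrier G" by blast
    show "\<forall>x\<in>\<Union>\<S>. \<exists>U\<in>\<N>. \<forall>u\<in>U. x \<otimes> u \<in> \<Union>\<S>"
    proof
      fix x assume "x \<in> \<Union>\<S>"
      then obtain S where S: "S \<in> \<S>" "x \<in> S" by blast
      then obtain U where "U \<in> \<N>" "\<forall>u\<in>U. x \<otimes> u \<in> S" using \<S> by blast
      then show "\<exists>U\<in>\<N>. \<forall>u\<in>U. x \<otimes> u \<in> \<Union>\<S>" using S(1) by blast
    qed
  qed
  then show ?thesis by (simp add: T_def)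
qed

lemma topspace_T: "topspace T = carrier G"
proof -
  have "openin T (carrier G)"
    using nonempty subset_carrier by (auto simp: openin_T subset_iff)
  then have "carrier G \<subseteq> topspace T" by (rule openin_subset)
  moreover have "topspace T \<subseteq> carrier G" using openin_T[of "topspace T"] by simp
  ultimately show ?thesis by blast
qed

lemma inverses: "U \<in> \<N> \<Longrightarrow> \<exists>V\<in>\<N>. \<forall>x\<in>V. inv x \<in> U"
  using quotients[of U] one_mem subset_carrier by (metis inv_closed l_one subsetD)

lemma products:
  assumes "U \<in> \<N>"
  shows "\<exists>V\<in>\<N>. \<forall>x\<in>V. \<forall>y\<in>V. x \<otimes> y \<in> U"
proof -
  obtain V where V: "V \<in> \<N>" "\<forall>x\<in>V. \<forall>y\<in>V. x \<otimes> inv y \<in> U" using quotients[OF assms] by blast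
  obtain V' where V': "V' \<in> \<N>" "\<forall>x\<in>V'. inv x \<in> V" using inverses[OF V(1)] by blast
  obtain W where W: "W \<in> \<N>" "W \<subseteq> V \<inter> V'" using directed[OF V(1) V'(1)] by blast
  have "x \<otimes> y \<in> U" if "x \<in> W" "y \<in> W" for x y
  proof -
    have "x \<otimes> inv (inv y) \<in> U" using V(2) V'(2) W(2) that by blast
    then show ?thesis using subset_carrier[OF W(1)] that by (simp add: subset_iff)
  qed
  then show ?thesis using W(1) by blast
qed

text \<open>The interior of a translate \<open>x U\<close> can be written down explicitly, and that it is open is
  precisely what the existence of \<open>V\<close> with \<open>V V \<subseteq> U\<close> gives.\<close>
lemma open_inside:
  assumes "x \<in> carrier G" "U \<in> \<N>"
  obtains S where "openin T S" "x \<in> S" "S \<subseteq> (\<lambda>u. x \<otimes> u) ` U"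
proof -
  let ?xU = "(\<lambda>u. x \<otimes> u) ` U"
  define S where "S = {z \<in> carrier G. \<exists>V\<in>\<N>. \<forall>v\<in>V. z \<otimes> v \<in> ?xU}"
  have "openin T S"
    unfolding openin_T
  proof (intro conjI ballI)
    show "S \<subseteq> carrier G" by (auto simp: S_def)
    fix z assume "z \<in> S"
    then obtain V where V: "z \<in> carrier G" "V \<in> \<N>" "\<forall>v\<in>V. z \<otimes> v \<in> ?xU"
      by (auto simp: S_def)
    obtain W where W: "W \<in> \<N>" "\<forall>x\<in>W. \<forall>y\<in>W. x \<otimes> y \<in> V" using products[OF V(2)] by blast
    have "z \<otimes> w \<in> S" if "w \<in> W" for w
    proof -
      have "(z \<otimes> w) \<otimes> w' \<in> ?xU" if w': "w' \<in> W" for w'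
      proof -
        have "w \<in> carrier G" "w' \<in> carrier G"
          using subset_carrier[OF W(1)] \<open>w \<in> W\<close> w' by auto
        moreover have "z \<otimes> (w \<otimes> w') \<in> ?xU" using V(3) W(2) \<open>w \<in> W\<close> w' by blast
        ultimately show ?thesis using V(1) by (simp add: m_assoc)
      qed
      then show ?thesis
        using subset_carrier[OF W(1)] that V(1) W(1) by (auto simp: S_def)
    qed
    then show "\<exists>U\<in>\<N>. \<forall>u\<in>U. z \<otimes> u \<in> S" using W(1) by blast
  qed
  moreover have "x \<in> S" using assms by (auto simp: S_def)
  moreover have "S \<subseteq> ?xU"
  proof
    fix z assume "z \<in> S"
    then obtain V where V: "z \<in> carrier G" "V \<in> \<N>" "\<forall>v\<in>V. z \<otimes> v \<in> ?xU"
      by (auto simp: S_def)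
    then have "z \<otimes> \<one> \<in> ?xU" using one_mem by blast
    then show "z \<in> ?xU" using V(1) by simp
  qed
  ultimately show ?thesis using that by blast
qed

lemma hausdorff_group_topology_T: "hausdorff_group_topology G T"
  unfolding hausdorff_group_topology_def
proof (intro conjI)
  show "topspace T = carrier G" by (rule topspace_T)
  show "Hausdorff_space T"
    unfolding Hausdorff_space_def topspace_T
  proof (intro allI impI)
    fix x y assume "x \<in> carrier G \<and> y \<in> carrier G \<and> x \<noteq> y"
    then have xy: "x \<in> carrier G" "y \<in> carrier G" "x \<noteq> y" by auto
    then have "inv x \<otimes> y \<noteq> \<one>" by (metis inv_equality inv_inv inv_closed)
    then obtain U where U: "U \<in> \<N>" "inv x \<otimes> y \<notin> U" using separating[of "inv x \<otimes> y"] xy by auto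
    obtain V where V: "V \<in> \<N>" "\<forall>x\<in>V. \<forall>y\<in>V. x \<otimes> inv y \<in> U" using quotients[OF U(1)] by blast
    obtain S where S: "openin T S" "x \<in> S" "S \<subseteq> (\<lambda>u. x \<otimes> u) ` V"
      using open_inside[OF xy(1) V(1)] .
    obtain S' where S': "openin T S'" "y \<in> S'" "S' \<subseteq> (\<lambda>u. y \<otimes> u) ` V"
      using open_inside[OF xy(2) V(1)] .
    have "disjnt S S'"
      unfolding disjnt_iff
    proof (intro allI notI)
      fix z assume "z \<in> S \<and> z \<in> S'"
      then obtain v w where vw: "v \<in> V" "w \<in> V" "x \<otimes> v = y \<otimes> w" using S(3) S'(3) by blast
      then have c: "v \<in> carrier G" "w \<in> carrier G" using subset_carrier[OF V(1)] by auto
      have "v \<otimes> inv w = inv x \<otimes> (x \<otimes> v) \<otimes> inv w" using xy c by (simp add: m_assoc[symmetric])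
      also have "\<dots> = inv x \<otimes> y" using xy c by (simp add: vw(3) m_assoc)
      finally show False using V(2) vw U(2) by metis
    qed
    then show "\<exists>S S'. openin T S \<and> openin T S' \<and> x \<in> S \<and> y \<in> S' \<and> disjnt S S'"
      using S S' by blast
  qed
  show "continuous_map (prod_topology T T) T (\<lambda>(a, b). a \<otimes> b)"
    unfolding continuous_map_def
  proof (intro conjI allI impI)
    show "(\<lambda>(a, b). a \<otimes> b) \<in> topspace (prod_topology T T) \<rightarrow> topspace T"
      by (auto simp: topspace_T)
    fix O' assume O': "openin T O'"
    show "openin (prod_topology T T)
      {x \<in> topspace (prod_topology T T). (case x of (a, b) \<Rightarrow> a \<otimes> b) \<in> O'}"
      unfolding openin_prod_topology_alt
    proof (intro allI impI)
      fix x y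
      assume "(x, y) \<in> {x \<in> topspace (prod_topology T T). (case x of (a, b) \<Rightarrow> a \<otimes> b) \<in> O'}"
      then have xy: "x \<in> carrier G" "y \<in> carrier G" "x \<otimes> y \<in> O'" by (auto simp: topspace_T)
      obtain U where U: "U \<in> \<N>" "\<forall>u\<in>U. x \<otimes> y \<otimes> u \<in> O'" using O' xy(3) by (auto simp: openin_T)
      obtain V where V: "V \<in> \<N>" "\<forall>x\<in>V. \<forall>y\<in>V. x \<otimes> y \<in> U" using products[OF U(1)] by blast
      \<comment> \<open>Since \<open>x w y v = x y (y\<inverse> w y) v\<close>, the left factor has to be controlled after
        conjugation by \<open>y\<close>.\<close>
      obtain W where W: "W \<in> \<N>" "\<forall>w\<in>W. inv y \<otimes> w \<otimes> inv (inv y) \<in> V"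
        using conjugates[OF V(1), of "inv y"] xy by blast
      obtain S where S: "openin T S" "x \<in> S" "S \<subseteq> (\<lambda>u. x \<otimes> u) ` W"
        using open_inside[OF xy(1) W(1)] .
      obtain S' where S': "openin T S'" "y \<in> S'" "S' \<subseteq> (\<lambda>u. y \<otimes> u) ` V"
        using open_inside[OF xy(2) V(1)] .
      have "a \<otimes> b \<in> O'" if ab: "a \<in> S" "b \<in> S'" for a b
      proof -
        obtain w v where wv: "w \<in> W" "a = x \<otimes> w" "v \<in> V" "b = y \<otimes> v" using S(3) S'(3) ab by blast
        then have c: "w \<in> carrier G" "v \<in> carrier G"
          using subset_carrier[OF W(1)] subset_carrier[OF V(1)] by auto
        have "x \<otimes> y \<otimes> ((inv y \<otimes> w \<otimes> inv (inv y)) \<otimes> v) \<in> O'" using U(2) V(2) W(2) wv by blast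
        moreover have "y \<otimes> (inv y \<otimes> (w \<otimes> (y \<otimes> v))) = w \<otimes> (y \<otimes> v)"
          using xy c by (simp add: m_assoc[symmetric])
        ultimately show ?thesis using xy c wv by (simp add: m_assoc)
      qed
      moreover have "S \<subseteq> carrier G" "S' \<subseteq> carrier G" using S S' by (auto simp: openin_T)
      ultimately show "\<exists>U V. openin T U \<and> openin T V \<and> x \<in> U \<and> y \<in> V \<and>
          U \<times> V \<subseteq> {x \<in> topspace (prod_topology T T). (case x of (a, b) \<Rightarrow> a \<otimes> b) \<in> O'}"
        using S S' by (intro exI[of _ S] exI[of _ S']) (auto simp: topspace_T)
    qed
  qed
  show "continuous_map T T (\<lambda>a. inv a)"
    unfolding continuous_map_def topspace_T
  proof (intro conjI allI impI)
    show "(\<lambda>a. inv a) \<in> carrier G \<rightarrow> carrier G" by auto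
    fix O' assume O': "openin T O'"
    show "openin T {x \<in> carrier G. inv x \<in> O'}"
    proof (subst openin_subopen, intro ballI)
      fix x assume "x \<in> {x \<in> carrier G. inv x \<in> O'}"
      then have x: "x \<in> carrier G" "inv x \<in> O'" by auto
      obtain U where U: "U \<in> \<N>" "\<forall>u\<in>U. inv x \<otimes> u \<in> O'" using O' x(2) by (auto simp: openin_T)
      \<comment> \<open>Here the relevant identity is \<open>(x w)\<inverse> = x\<inverse> (x w\<inverse> x\<inverse>)\<close>.\<close>
      obtain V where V: "V \<in> \<N>" "\<forall>v\<in>V. x \<otimes> v \<otimes> inv x \<in> U" using conjugates[OF U(1) x(1)] by blast
      obtain W where W: "W \<in> \<N>" "\<forall>w\<in>W. inv w \<in> V" using inverses[OF V(1)] by blast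
      obtain S where S: "openin T S" "x \<in> S" "S \<subseteq> (\<lambda>u. x \<otimes> u) ` W"
        using open_inside[OF x(1) W(1)] .
      have "inv a \<in> O'" if a: "a \<in> S" for a
      proof -
        obtain w where w: "w \<in> W" "a = x \<otimes> w" using S(3) a by blast
        then have c: "w \<in> carrier G" using subset_carrier[OF W(1)] by auto
        have "inv x \<otimes> (x \<otimes> inv w \<otimes> inv x) \<in> O'" using U(2) V(2) W(2) w(1) by blast
        moreover have "inv x \<otimes> (x \<otimes> inv w \<otimes> inv x) = inv a"
          using x(1) c w(2) by (simp add: inv_mult_group m_assoc[symmetric])
        ultimately show ?thesis by simp
      qed
      then show "\<exists>S. openin T S \<and> x \<in> S \<and> S \<subseteq> {x \<in> carrier G. inv x \<in> O'}"
        using S by (intro exI[of _ S]) (auto simp: openin_T)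
    qed
  qed
qed

end

section \<open>Markov's construction of neighbourhoods in a countable group\<close>

text \<open>The \<open>n\<close>-th neighbourhood consists of the \<open>x\<close> with \<open>small G g a n x\<close>. The rules say that \<open>a n\<close>
  belongs to it and that the axioms of a group topology hold with modulus \<open>n \<mapsto> n + 1\<close>. When \<open>g\<close>
  enumerates the group, the bound \<open>i \<le> n\<close> admits each conjugation from some index on, while it
  leaves only finitely many conjugations at each index, so that a sequence \<open>a\<close> that is eventually
  trivial generates finite neighbourhoods.\<close>
inductive small :: "('a, 'c) monoid_scheme \<Rightarrow> (nat \<Rightarrow> 'a) \<Rightarrow> (nat \<Rightarrow> 'a) \<Rightarrow> nat \<Rightarrow> 'a \<Rightarrow> bool"
  for G :: "('a, 'c) monoid_scheme" and g a :: "nat \<Rightarrow> 'a" where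
  one: "small G g a n \<one>\<^bsub>G\<^esub>"
| seq: "small G g a n (a n)"
| quotient: "small G g a (Suc n) x \<Longrightarrow> small G g a (Suc n) y \<Longrightarrow> small G g a n (x \<otimes>\<^bsub>G\<^esub> inv\<^bsub>G\<^esub> y)"
| conjugate: "small G g a (Suc n) x \<Longrightarrow> i \<le> n \<Longrightarrow> small G g a n (g i \<otimes>\<^bsub>G\<^esub> x \<otimes>\<^bsub>G\<^esub> inv\<^bsub>G\<^esub> (g i))"

lemma small_iff:
  "small G g a n x \<longleftrightarrow> x = \<one>\<^bsub>G\<^esub> \<or> x = a n
    \<or> (\<exists>y z. small G g a (Suc n) y \<and> small G g a (Suc n) z \<and> x = y \<otimes>\<^bsub>G\<^esub> inv\<^bsub>G\<^esub> z)
    \<or> (\<exists>i\<le>n. \<exists>y. small G g a (Suc n) y \<and> x = g i \<otimes>\<^bsub>G\<^esub> y \<otimes>\<^bsub>G\<^esub> inv\<^bsub>G\<^esub> (g i))"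
  by (subst small.simps) blast

context group
begin

lemma small_closed:
  assumes "small G g a n x" "subgroup H G" "range g \<subseteq> H" "range a \<subseteq> H"
  shows "x \<in> H"
  using assms(1)
proof induction
  case (one n)
  show ?case using subgroup.one_closed[OF assms(2)] .
next
  case (seq n)
  show ?case using assms(4) by blast
next
  case (quotient n x y)
  then show ?case
    by (intro subgroup.m_closed[OF assms(2)] subgroup.m_inv_closed[OF assms(2)])
next
  case (conjugate n x i)
  moreover have "g i \<in> H" using assms(3) by blast
  ultimately show ?case
    by (intro subgroup.m_closed[OF assms(2)] subgroup.m_inv_closed[OF assms(2)])
qed

text \<open>The neighbourhoods decrease because the quotient of \<open>x\<close> by the identity is \<open>x\<close>.\<close>
lemma small_antimono:
  assumes "small G g a n x" "m \<le> n" "range g \<subseteq> carrier G" "range a \<subseteq> carrier G"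
  shows "small G g a m x"
  using assms(2,1)
proof (induction rule: inc_induct)
  case (step k)
  then have "small G g a k (x \<otimes> inv \<one>)" by (intro small.quotient small.one)
  moreover have "x \<in> carrier G"
    using small_closed[OF step.prems subgroup_self] assms(3,4) by simp
  ultimately show ?case by simp
qed

lemma small_trivial:
  assumes "small G g a n x" "\<And>k. k \<ge> n \<Longrightarrow> a k = \<one>" "range g \<subseteq> carrier G"
  shows "x = \<one>"
  using assms(1,2)
proof induction
  case (conjugate n x i)
  have "g i \<in> carrier G" using assms(3) by blast
  then show ?case using conjugate by simp
qed simp_all

text \<open>A derivation uses only finitely many entries of the sequence. This is what lets a property of
  the limit sequence be checked on its finite initial segments.\<close>
lemma small_finite_stage:
  assumes "small G g a n x"
  shows "\<exists>N. \<forall>b. (\<forall>k<N. b k = a k) \<longrightarrow> small G g b n x"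
  using assms
proof induction
  case (one n)
  show ?case by (auto intro: small.one)
next
  case (seq n)
  have "small G g b n (a n)" if "\<forall>k<Suc n. b k = a k" for b
    using small.seq[of G g b n] that by simp
  then show ?case by blast
next
  case (quotient n x y)
  then obtain N M where NM: "\<forall>b. (\<forall>k<N. b k = a k) \<longrightarrow> small G g b (Suc n) x"
    "\<forall>b. (\<forall>k<M. b k = a k) \<longrightarrow> small G g b (Suc n) y" by blast
  have "small G g b n (x \<otimes> inv y)" if "\<forall>k<max N M. b k = a k" for b
    using NM that by (intro small.quotient) auto
  then show ?case by blast
next
  case (conjugate n x i)
  then show ?case by (blast intro: small.conjugate)
qed

text \<open>If one entry of an eventually trivial sequence varies, the elements of each neighbourhood are
  the values of finitely many words at that entry, the same words for all its values. The
  induction descends from the indices beyond \<open>N\<close>, where the neighbourhoods are trivial.\<close>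
lemma small_word_maps:
  assumes H: "subgroup H G" and g: "range g \<subseteq> H" and s: "range s \<subseteq> H" "\<And>k. k > N \<Longrightarrow> s k = \<one>"
  shows "\<exists>W. finite W \<and> W \<subseteq> word_maps G H \<and> (\<forall>t. {x. small G g (s(N := t)) m x} = (\<lambda>p. p t) ` W)"
proof -
  have gG: "range g \<subseteq> carrier G" using g subgroup.subset[OF H] by blast
  have one: "(\<lambda>_. \<one>) \<in> word_maps G H" by (intro word_maps.const subgroup.one_closed[OF H])
  show ?thesis
  proof (induction "Suc N - m" arbitrary: m)
    case 0
    have "{x. small G g (s(N := t)) m x} = (\<lambda>p. p t) ` {\<lambda>_. \<one>}" for t
      using small_trivial[OF _ _ gG, of "s(N := t)" m] s(2) 0 by (auto intro: small.one)
    then show ?case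
      using one by (intro exI[of _ "{\<lambda>_. \<one>}"]) (simp del: fun_upd_apply)
  next
    case (Suc d)
    then have "d = Suc N - Suc m" by simp
    from Suc.hyps(1)[OF this] obtain W where W: "finite W" "W \<subseteq> word_maps G H"
      "\<And>t. {x. small G g (s(N := t)) (Suc m) x} = (\<lambda>p. p t) ` W" by blast
    define e where "e = (if m = N then (\<lambda>t. t) else (\<lambda>_. s m))"
    define W' where "W' = {\<lambda>_. \<one>, e} \<union> (\<lambda>(p, q) t. p t \<otimes> inv (q t)) ` (W \<times> W)
      \<union> (\<lambda>(i, p) t. g i \<otimes> p t \<otimes> inv (g i)) ` ({..m} \<times> W)"
    have "finite W'" using W(1) by (simp add: W'_def)
    moreover have "W' \<subseteq> word_maps G H"
    proof -
      have "e \<in> word_maps G H"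
        using s(1) by (auto simp: e_def intro: word_maps.var word_maps.const)
      moreover have "(\<lambda>t. p t \<otimes> inv (q t)) \<in> word_maps G H" if "p \<in> W" "q \<in> W" for p q
        using that W(2) by (intro word_maps.mult word_maps.inv) auto
      moreover have "(\<lambda>t. g i \<otimes> p t \<otimes> inv (g i)) \<in> word_maps G H" if "p \<in> W" for i p
      proof -
        have "g i \<in> H" using g by blast
        then show ?thesis
          using that W(2) by (intro word_maps.mult word_maps.inv[of "\<lambda>_. g i"] word_maps.const) auto
      qed
      ultimately show ?thesis using one by (simp add: W'_def image_subset_iff)
    qed
    moreover have "{x. small G g (s(N := t)) m x} = (\<lambda>p. p t) ` W'" for t
    proof -
      have e: "(s(N := t)) m = e t" by (simp add: e_def)
      define S where "S = (\<lambda>p. p t) ` W"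
      have S: "small G g (s(N := t)) (Suc m) y \<longleftrightarrow> y \<in> S" for y
        using W(3)[of t] by (simp add: S_def set_eq_iff)
      have "small G g (s(N := t)) m x \<longleftrightarrow> x \<in> (\<lambda>p. p t) ` W'" for x
      proof -
        have "small G g (s(N := t)) m x \<longleftrightarrow> x = \<one> \<or> x = e t
            \<or> (\<exists>y\<in>S. \<exists>z\<in>S. x = y \<otimes> inv z) \<or> (\<exists>i\<in>{..m}. \<exists>y\<in>S. x = g i \<otimes> y \<otimes> inv (g i))"
          unfolding small_iff[of G g _ m] S e by blast
        also have "\<dots> \<longleftrightarrow> x \<in> (\<lambda>p. p t) ` W'"
          unfolding W'_def S_def
          by (simp add: image_Un image_image case_prod_unfold image_iff split_paired_Bex_Sigma
              del: atMost_iff)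
        finally show ?thesis .
      qed
      then show ?thesis by (simp only: set_eq_iff mem_Collect_eq simp_thms)
    qed
    ultimately show ?case by blast
  qed
qed

text \<open>The heart of Markov's theorem. The entries of \<open>a\<close> are chosen one at a time, with all later
  entries still equal to the identity. Replacing the entry at \<open>N\<close> by \<open>t\<close> could put some \<open>g j\<close> into
  the neighbourhood \<open>j + 1\<close> only if a word \<open>p\<close> of a finite set satisfies \<open>p t = g j\<close>. None of
  these equations holds for \<open>t = \<one>\<close>, as that is the previous sequence, so adherence of the identity
  to \<open>A\<close> yields a \<open>t\<close> in \<open>A\<close> that violates all of them.\<close>
lemma exists_small_sequence:
  assumes H: "subgroup H G" and g: "range g \<subseteq> H" and A: "A \<subseteq> H"
    and adherent: "one_adherent G H A"
  obtains a where "range a \<subseteq> A" "\<And>j. g j \<noteq> \<one> \<Longrightarrow> \<not> small G g a (Suc j) (g j)"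
proof -
  have HG: "H \<subseteq> carrier G" using subgroup.subset[OF H] .
  have gG: "range g \<subseteq> carrier G" using g HG by blast
  have oneH: "\<one> \<in> H" using subgroup.one_closed[OF H] .
  define ok where "ok N s \<longleftrightarrow> range s \<subseteq> H \<and> (\<forall>k\<ge>N. s k = \<one>)
    \<and> (\<forall>j. g j \<noteq> \<one> \<longrightarrow> \<not> small G g s (Suc j) (g j))" for N s
  have step: "\<exists>t\<in>A. ok (Suc N) (s(N := t))" if "ok N s" for N s
  proof -
    have s: "range s \<subseteq> H" "\<And>k. k \<ge> N \<Longrightarrow> s k = \<one>"
      "\<And>j. g j \<noteq> \<one> \<Longrightarrow> \<not> small G g s (Suc j) (g j)"
      using that by (auto simp: ok_def)
    have "\<forall>m. \<exists>W. finite W \<and> W \<subseteq> word_maps G H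
        \<and> (\<forall>t. {x. small G g (s(N := t)) m x} = (\<lambda>p. p t) ` W)"
      using small_word_maps[OF H g s(1)] s(2) by simp
    then obtain W where W: "\<And>m. finite (W m)" "\<And>m. W m \<subseteq> word_maps G H"
      "\<And>m t. {x. small G g (s(N := t)) m x} = (\<lambda>p. p t) ` W m"
      by metis
    \<comment> \<open>Only \<open>j < N\<close> gives a condition: for \<open>j \<ge> N\<close> the neighbourhood \<open>j + 1\<close> lies beyond the last
      nontrivial entry and is \<open>{\<one>}\<close>.\<close>
    define Q where "Q = (\<Union>j\<in>{j. j < N \<and> g j \<noteq> \<one>}. (\<lambda>p t. p t \<otimes> inv (g j)) ` W (Suc j))"
    have closed: "p t \<in> carrier G" if "p \<in> W m" "t \<in> H" for p m t
    proof -
      have "p \<in> word_maps G H" using that(1) W(2) by blast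
      from word_maps_closed[OF this H subset_refl that(2)] show ?thesis using HG by blast
    qed
    have gc: "g j \<in> carrier G" for j using gG by blast
    have "finite Q" using W(1) by (simp add: Q_def)
    moreover have "Q \<subseteq> word_maps G H"
    proof -
      have "(\<lambda>t. p t \<otimes> inv (g j)) \<in> word_maps G H" if "p \<in> W (Suc j)" for p j
      proof -
        have "g j \<in> H" using g by blast
        then show ?thesis
          using that W(2)
          by (intro word_maps.mult word_maps.inv[of "\<lambda>_. g j"] word_maps.const) auto
      qed
      then show ?thesis by (simp add: Q_def UN_subset_iff image_subset_iff)
    qed
    moreover have "\<forall>q\<in>Q. q \<one> \<noteq> \<one>"
    proof
      fix q assume "q \<in> Q"
      then obtain j p where q: "g j \<noteq> \<one>" "p \<in> W (Suc j)" "q = (\<lambda>t. p t \<otimes> inv (g j))"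
        unfolding Q_def by fastforce
      have "p \<one> \<in> {x. small G g (s(N := \<one>)) (Suc j) x}" using W(3)[of \<one> "Suc j"] q(2) by blast
      moreover have "s(N := \<one>) = s" using s(2)[of N] by auto
      ultimately have "p \<one> \<noteq> g j" using s(3)[OF q(1)] by auto
      then show "q \<one> \<noteq> \<one>"
        using closed[OF q(2) oneH] gc[of j] by (metis inv_equality inv_inv inv_closed q(3))
    qed
    ultimately obtain t where t: "t \<in> A" "\<forall>q\<in>Q. q t \<noteq> \<one>" by (rule one_adherentD[OF adherent])
    then have tH: "t \<in> H" using A by blast
    have "\<not> small G g (s(N := t)) (Suc j) (g j)" if j: "g j \<noteq> \<one>" for j
    proof
      assume small: "small G g (s(N := t)) (Suc j) (g j)"
      show False
      proof (cases "j < N")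
        case True
        have "g j \<in> (\<lambda>p. p t) ` W (Suc j)" using small W(3)[of t "Suc j"] by blast
        then obtain p where p: "p \<in> W (Suc j)" "g j = p t" by blast
        then have "(\<lambda>t. p t \<otimes> inv (g j)) \<in> Q" using True j unfolding Q_def by blast
          from bspec[OF t(2) this] have "p t \<otimes> inv (g j) \<noteq> \<one>" .
        then show False using p(2) gc[of j] by simp
      next
        case False
        then have "g j = \<one>"
          using small_trivial[OF small _ gG] s(2) by simp
        then show False using j by simp
      qed
    qed
    moreover have "range (s(N := t)) \<subseteq> H" using s(1) tH by (auto simp: fun_upd_def)
    ultimately have "ok (Suc N) (s(N := t))" using s(2) by (simp add: ok_def)
    then show ?thesis using t(1) by blast
  qed
  have "ok 0 (\<lambda>_. \<one>)"
  proof -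
    have "\<not> small G g (\<lambda>_. \<one>) (Suc j) (g j)" if "g j \<noteq> \<one>" for j
      using small_trivial[OF _ _ gG, of "\<lambda>_. \<one>" "Suc j" "g j"] that by blast
    then show ?thesis using oneH by (auto simp: ok_def)
  qed
  then obtain S where S: "\<And>N. ok N (S N)" "\<And>N. \<exists>t\<in>A. S (Suc N) = (S N)(N := t)"
    using dependent_nat_choice[of ok "\<lambda>N s s'. \<exists>t\<in>A. s' = s(N := t)"] step by metis
  \<comment> \<open>Entry \<open>n\<close> is fixed in passing from stage \<open>n\<close> to stage \<open>n + 1\<close> and never changes afterwards.\<close>
  define a where "a n = S (Suc n) n" for n
  have agree: "S N k = a k" if "k < N" for N k
    using that
  proof (induction N)
    case (Suc N)
    obtain t where "S (Suc N) = (S N)(N := t)" using S(2) by blast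
    then show ?case using Suc by (cases "k = N") (auto simp: a_def)
  qed simp
  have "a n \<in> A" for n
  proof -
    obtain t where "t \<in> A" "S (Suc n) = (S n)(n := t)" using S(2) by blast
    then show ?thesis by (simp add: a_def)
  qed
  moreover have "\<not> small G g a (Suc j) (g j)" if "g j \<noteq> \<one>" for j
  proof
    assume "small G g a (Suc j) (g j)"
    then obtain N where "\<forall>b. (\<forall>k<N. b k = a k) \<longrightarrow> small G g b (Suc j) (g j)"
      using small_finite_stage by blast
    then have "small G g (S N) (Suc j) (g j)" using agree by blast
    then show False using S(1)[of N] that by (simp add: ok_def)
  qed
  ultimately show ?thesis using that[of a] by blast
qed

end

section \<open>Extending topologies along retractions\<close>

text \<open>The topology is the initial one for the family of retractions of \<open>G\<close> onto \<open>H\<close>, where \<open>H\<close> carries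
  the topology given by Markov's neighbourhoods. It is a group topology as the retractions are
  homomorphisms, and Hausdorff as they separate points. All retractions fix the sequence \<open>a\<close>, whose
  entries therefore lie in the basic neighbourhoods of \<open>G\<close>. For countable \<open>G\<close> one may take
  \<open>H = carrier G\<close> and the identity as the only retraction, which is Markov's theorem.\<close>
lemma (in group) topology_with_adherent_set:
  assumes H: "subgroup H G" "countable H" and A: "A \<subseteq> H"
    and retractions: "\<And>x. x \<in> carrier G \<Longrightarrow> x \<noteq> \<one> \<Longrightarrow>
      \<exists>\<phi>\<in>hom G G. \<phi> ` carrier G \<subseteq> H \<and> (\<forall>h\<in>H. \<phi> h = h) \<and> \<phi> x \<noteq> \<one>"
    and adherent: "one_adherent G H A"
  obtains T where "hausdorff_group_topology G T"
    "\<And>S b. openin T S \<Longrightarrow> b \<in> S \<Longrightarrow> \<exists>a\<in>A. b \<otimes> a \<in> S"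
proof -
  have HG: "H \<subseteq> carrier G" using subgroup.subset[OF H(1)] .
  define g where "g = from_nat_into H"
  have g: "range g = H"
    using range_from_nat_into[OF _ H(2)] subgroup.one_closed[OF H(1)] by (auto simp: g_def)
  then have gH: "range g \<subseteq> H" by simp
  obtain a where a: "range a \<subseteq> A" "\<And>j. g j \<noteq> \<one> \<Longrightarrow> \<not> small G g a (Suc j) (g j)"
    using exists_small_sequence[OF H(1) gH A adherent] by blast
  have gG: "range g \<subseteq> carrier G" and aG: "range a \<subseteq> carrier G" using gH a(1) A HG by auto
  note antimono = small_antimono[OF _ _ gG aG]
  define R where "R = {\<phi> \<in> hom G G. \<phi> ` carrier G \<subseteq> H \<and> (\<forall>h\<in>H. \<phi> h = h)}"
  define U where "U F n = {x \<in> carrier G. \<forall>\<phi>\<in>F. small G g a n (\<phi> x)}" for F :: "('a \<Rightarrow> 'a) set" and n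
  define \<N> where "\<N> = {U F n | F n. finite F \<and> F \<subseteq> R}"
  have R_hom: "group_hom G G \<phi>" if "\<phi> \<in> R" for \<phi>
    using that by (simp add: R_def group_hom_def group_hom_axioms_def)
  have U: "U F n \<in> \<N>" if "finite F" "F \<subseteq> R" for F n
    using that by (auto simp: \<N>_def)
  interpret N: identity_nbhd_base G \<N>
  proof
    show "\<N> \<noteq> {}" using U[of "{}" 0] by auto
  next
    fix V assume "V \<in> \<N>"
    then obtain F n where V: "V = U F n" "finite F" "F \<subseteq> R" by (auto simp: \<N>_def)
    show "V \<subseteq> carrier G" by (auto simp: V(1) U_def)
    show "\<one> \<in> V"
    proof -
      have "small G g a n (\<phi> \<one>)" if "\<phi> \<in> F" for \<phi>
      proof -
        have "\<phi> \<one> = \<one>" using group_hom.hom_one[OF R_hom] V(3) that by blast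
        then show ?thesis by (simp only: small.one)
      qed
      then show ?thesis by (simp add: V(1) U_def)
    qed
    show "\<exists>W\<in>\<N>. \<forall>x\<in>W. \<forall>y\<in>W. x \<otimes> inv y \<in> V"
    proof (intro bexI[of _ "U F (Suc n)"] ballI U V(2,3))
      fix x y assume xy: "x \<in> U F (Suc n)" "y \<in> U F (Suc n)"
      then have c: "x \<in> carrier G" "y \<in> carrier G" by (auto simp: U_def)
      have "small G g a n (\<phi> (x \<otimes> inv y))" if "\<phi> \<in> F" for \<phi>
      proof -
        interpret \<phi>: group_hom G G \<phi> using R_hom that V(3) by blast
        have "small G g a n (\<phi> x \<otimes> inv (\<phi> y))"
          using xy that by (intro small.quotient) (auto simp: U_def)
        then show ?thesis using c by simp
      qed
      then show "x \<otimes> inv y \<in> V" using c by (simp add: V(1) U_def)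
    qed
    fix y assume y: "y \<in> carrier G"
    show "\<exists>W\<in>\<N>. \<forall>x\<in>W. y \<otimes> x \<otimes> inv y \<in> V"
    proof -
      have "\<forall>\<phi>\<in>F. \<exists>i. g i = \<phi> y"
      proof
        fix \<phi> assume "\<phi> \<in> F"
        then have "\<phi> y \<in> H" using V(3) y by (auto simp: R_def)
        then show "\<exists>i. g i = \<phi> y" using g by (metis imageE)
      qed
      then obtain i where i: "\<forall>\<phi>\<in>F. g (i \<phi>) = \<phi> y" by metis
      \<comment> \<open>The sum is a convenient common upper bound of \<open>n\<close> and of the indices of the finitely many
        elements \<open>\<phi> y\<close> by which the images are conjugated.\<close>
      define m where "m = n + (\<Sum>\<phi>\<in>F. i \<phi>)"
      have m: "n \<le> m" "i \<phi> \<le> m" if "\<phi> \<in> F" for \<phi>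
        using member_le_sum[of \<phi> F i] V(2) that by (auto simp: m_def)
      show ?thesis
      proof (intro bexI[of _ "U F (Suc m)"] ballI U V(2,3))
        fix x assume x: "x \<in> U F (Suc m)"
        then have c: "x \<in> carrier G" by (auto simp: U_def)
        have "small G g a n (\<phi> (y \<otimes> x \<otimes> inv y))" if \<phi>: "\<phi> \<in> F" for \<phi>
        proof -
          interpret \<phi>: group_hom G G \<phi> using R_hom \<phi> V(3) by blast
          have "small G g a m (g (i \<phi>) \<otimes> \<phi> x \<otimes> inv (g (i \<phi>)))"
            using x \<phi> m(2)[OF \<phi>] by (intro small.conjugate) (auto simp: U_def)
          then have "small G g a m (\<phi> (y \<otimes> x \<otimes> inv y))" using c y i \<phi> by simp
          then show ?thesis using m(1)[OF \<phi>] by (rule antimono)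
        qed
        then show "y \<otimes> x \<otimes> inv y \<in> V" using c y by (simp add: V(1) U_def)
      qed
    qed
  next
    fix V V' assume "V \<in> \<N>" "V' \<in> \<N>"
    then obtain F n F' n' where V: "V = U F n" "finite F" "F \<subseteq> R" "V' = U F' n'" "finite F'" "F' \<subseteq> R"
      by (auto simp: \<N>_def)
    have "U (F \<union> F') (max n n') \<subseteq> V \<inter> V'"
      using antimono[of "max n n'" _ n] antimono[of "max n n'" _ n'] by (auto simp: V U_def)
    moreover have "U (F \<union> F') (max n n') \<in> \<N>" using V by (intro U) auto
    ultimately show "\<exists>W\<in>\<N>. W \<subseteq> V \<inter> V'" by blast
  next
    fix x assume "x \<in> carrier G" "x \<noteq> \<one>"
    then obtain \<phi> where \<phi>: "\<phi> \<in> R" "\<phi> x \<noteq> \<one>" using retractions[of x] by (auto simp: R_def)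
    then have "\<phi> x \<in> H" using \<open>x \<in> carrier G\<close> by (auto simp: R_def)
    then obtain j where "\<phi> x = g j" using g by (metis imageE)
    then have "x \<notin> U {\<phi>} (Suc j)" using a(2)[of j] \<phi>(2) by (simp add: U_def)
    then show "\<exists>U\<in>\<N>. x \<notin> U" using U[of "{\<phi>}"] \<phi>(1) by blast
  qed
  show ?thesis
  proof (rule that[OF N.hausdorff_group_topology_T])
    fix S b assume "openin N.T S" "b \<in> S"
    then obtain V where V: "V \<in> \<N>" "\<forall>u\<in>V. b \<otimes> u \<in> S" by (auto simp: N.openin_T)
    then obtain F n where F: "V = U F n" "F \<subseteq> R" by (auto simp: \<N>_def)
    have "a n \<in> A" using a(1) by blast
    moreover have "small G g a n (\<phi> (a n))" if "\<phi> \<in> F" for \<phi>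
    proof -
      have "\<phi> (a n) = a n" using that F(2) \<open>a n \<in> A\<close> A by (auto simp: R_def)
      then show ?thesis by (simp only: small.seq)
    qed
    then have "a n \<in> V" using aG by (auto simp: F(1) U_def)
    ultimately show "\<exists>a\<in>A. b \<otimes> a \<in> S" using V(2) by blast
  qed
qed

section \<open>Free bases\<close>

text \<open>The extension property is asked for maps into \<open>G\<close> itself only. Endomorphisms are all
  that the argument uses, and for them the property can be stated without quantifying over groups.\<close>
definition free_basis :: "('a, 'c) monoid_scheme \<Rightarrow> 'x set \<Rightarrow> ('x \<Rightarrow> 'a) \<Rightarrow> bool"
  where "free_basis G X e \<longleftrightarrow> e ` X \<subseteq> carrier G \<and> generate G (e ` X) = carrier G
    \<and> (\<forall>f. f ` X \<subseteq> carrier G \<longrightarrow> (\<exists>\<phi>\<in>hom G G. \<forall>x\<in>X. \<phi> (e x) = f x))"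

lemma iso_free_group_has_basis:
  assumes "group G" "free_group X \<cong> G"
  shows "\<exists>e. free_basis G X e"
proof -
  interpret G: group G by fact
  interpret F: group "free_group X" by (rule group_free_group)
  obtain h where h: "h \<in> iso (free_group X) G" using assms(2) by (auto simp: is_iso_def)
  then have h_hom: "h \<in> hom (free_group X) G" and bij: "bij_betw h (carrier (free_group X)) (carrier G)"
    by (auto simp: iso_def)
  interpret h: group_hom "free_group X" G h
    using h_hom by unfold_locales
  let ?L = "X \<times> (UNIV :: bool set)" and ?R = "{([(x, b), (x, \<not> b)], []) | x b. x \<in> X}"
  define c where "c x b = word_class ?L ?R [(x, b)]" for x b
  define e where "e x = h (c x True)" for x
  have class_carrier: "word_class ?L ?R u \<in> carrier (free_group X)" if "u \<in> lists ?L" for u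
    using that unfolding free_group_def carrier_presented_monoid by (rule imageI)
  have c: "c x b \<in> carrier (free_group X)" if "x \<in> X" for x b
    unfolding c_def by (rule class_carrier) (use that in simp)
  have eG: "e ` X \<subseteq> carrier G" using c h.hom_closed by (auto simp: e_def)
  have inv_c: "h (c x False) = inv\<^bsub>G\<^esub> (e x)" if x: "x \<in> X" for x
  proof -
    have "([(x, False), (x, \<not> False)], []) \<in> ?R" using x by blast
    then have "([(x, False), (x, True)], []) \<in> ?R" by simp
    from word_cong.rel[OF this, of ?L "[]" "[]"]
    have "([(x, False), (x, True)], []) \<in> word_cong ?L ?R" using x by simp
    then have "word_class ?L ?R ([(x, False)] @ [(x, True)]) = word_class ?L ?R []"
      by (subst word_class_eq_iff) (use x in simp_all)
    moreover have "word_class ?L ?R ([(x, False)] @ [(x, True)]) = c x False \<otimes>\<^bsub>free_group X\<^esub> c x True"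
      unfolding c_def free_group_def by (rule mult_presented_monoid[symmetric]) (use x in simp_all)
    ultimately have "c x False \<otimes>\<^bsub>free_group X\<^esub> c x True = \<one>\<^bsub>free_group X\<^esub>"
      by (simp add: free_group_def one_presented_monoid)
    from arg_cong[OF this, of h] have "h (c x False) \<otimes>\<^bsub>G\<^esub> e x = \<one>\<^bsub>G\<^esub>"
      unfolding e_def by (simp only: h.hom_mult[OF c[OF x] c[OF x]] h.hom_one)
    then have "inv\<^bsub>G\<^esub> (e x) = h (c x False)"
      using eG x h.hom_closed[OF c[OF x]] by (intro G.inv_equality) auto
    then show ?thesis ..
  qed
  have gen: "h (word_class ?L ?R u) \<in> generate G (e ` X)" if "u \<in> lists ?L" for u
    using that
  proof (induction u)
    case Nil
    have "h (word_class ?L ?R []) = \<one>\<^bsub>G\<^esub>"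
      using h.hom_one by (simp add: free_group_def one_presented_monoid)
    then show ?case by (simp add: generate.one)
  next
    case (Cons l u)
    obtain x b where l: "l = (x, b)" "x \<in> X" using Cons.hyps(1) by blast
    have "word_class ?L ?R ([l] @ u) = c x b \<otimes>\<^bsub>free_group X\<^esub> word_class ?L ?R u"
      unfolding c_def free_group_def l(1)[symmetric]
      by (rule mult_presented_monoid[symmetric]) (use Cons.hyps in simp_all)
    then have "h (word_class ?L ?R (l # u)) = h (c x b) \<otimes>\<^bsub>G\<^esub> h (word_class ?L ?R u)"
      using h.hom_mult[OF c[OF l(2)] class_carrier[OF Cons.hyps(2)]] by simp
    moreover have "h (c x b) \<in> generate G (e ` X)"
    proof (cases b)
      case True
      then show ?thesis using l(2) by (auto simp: e_def intro: generate.incl)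
    next
      case False
      then show ?thesis using l(2) inv_c by (auto intro: generate.inv)
    qed
    ultimately show ?case using Cons.IH by (auto intro: generate.eng)
  qed
  have "carrier G \<subseteq> generate G (e ` X)"
  proof
    fix y assume "y \<in> carrier G"
    then have "y \<in> h ` carrier (free_group X)" using bij by (simp add: bij_betw_def)
    then show "y \<in> generate G (e ` X)"
      using gen unfolding free_group_def carrier_presented_monoid by blast
  qed
  then have "generate G (e ` X) = carrier G" using G.generate_incl[OF eG] by blast
  moreover have "\<exists>\<phi>\<in>hom G G. \<forall>x\<in>X. \<phi> (e x) = f x" if f: "f ` X \<subseteq> carrier G" for f
  proof -
    have "f \<in> X \<rightarrow> carrier G" using f by blast
    from ex1_implies_ex[OF free_group_universal[OF assms(1) this]]
    obtain k where k: "k \<in> hom (free_group X) G" "\<forall>x\<in>X. k (c x True) = f x"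
      unfolding c_def by blast
    let ?i = "inv_into (carrier (free_group X)) h"
    have "?i \<in> hom G (free_group X)" using F.iso_set_sym[OF h] by (simp add: iso_def)
    then have "k \<circ> ?i \<in> hom G G" using k(1) by (rule hom_compose)
    moreover have "(k \<circ> ?i) (e x) = f x" if "x \<in> X" for x
      using k(2) that bij c[OF that] by (simp add: e_def bij_betw_def inv_into_f_f)
    ultimately show ?thesis by blast
  qed
  ultimately show ?thesis using eG by (auto simp: free_basis_def)
qed

lemma (in group) hom_eq_on_generate:
  assumes "\<phi> \<in> hom G G" "\<psi> \<in> hom G G" "B \<subseteq> carrier G" "\<And>b. b \<in> B \<Longrightarrow> \<phi> b = \<psi> b"
    and "x \<in> generate G B"
  shows "\<phi> x = \<psi> x"
proof -
  interpret \<phi>: group_hom G G \<phi> using assms(1) by unfold_locales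
  interpret \<psi>: group_hom G G \<psi> using assms(2) by unfold_locales
  show ?thesis
    using assms(5)
  proof induction
    case (inv b)
    then show ?case using assms(3,4) by (auto simp: subset_iff)
  next
    case (eng x y)
    then show ?case using generate_in_carrier[OF assms(3)] by simp
  qed (use assms(4) in simp_all)
qed

lemma (in group) generate_finitary:
  assumes "finite C" "C \<subseteq> generate G (e ` Y)"
  obtains F where "finite F" "F \<subseteq> Y" "C \<subseteq> generate G (e ` F)"
proof -
  have mono: "generate G (e ` F) \<subseteq> generate G (e ` F')" if "F \<subseteq> F'" for F F'
    using that by (intro mono_generate image_mono)
  have single: "\<exists>F. finite F \<and> F \<subseteq> Y \<and> x \<in> generate G (e ` F)" if "x \<in> generate G (e ` Y)" for x
    using that
  proof induction
    case one
    then show ?case by (intro exI[of _ "{}"]) (simp add: generate.one)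
  next
    case (incl b)
    then obtain y where "y \<in> Y" "b = e y" by blast
    then show ?case by (intro exI[of _ "{y}"]) (simp add: generate.incl)
  next
    case (inv b)
    then obtain y where "y \<in> Y" "b = e y" by blast
    then show ?case by (intro exI[of _ "{y}"]) (simp add: generate.inv)
  next
    case (eng x y)
    then obtain F F' where F: "finite F" "F \<subseteq> Y" "x \<in> generate G (e ` F)"
      "finite F'" "F' \<subseteq> Y" "y \<in> generate G (e ` F')" by blast
    then have "x \<otimes> y \<in> generate G (e ` (F \<union> F'))"
      using mono[of F "F \<union> F'"] mono[of F' "F \<union> F'"] by (intro generate.eng) auto
    then show ?case using F by (intro exI[of _ "F \<union> F'"]) simp
  qed
  have "\<exists>F. finite F \<and> F \<subseteq> Y \<and> C \<subseteq> generate G (e ` F)"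
    using assms
  proof induction
    case empty
    show ?case by (intro exI[of _ "{}"]) simp
  next
    case (insert x C)
    then obtain F F' where F: "finite F" "F \<subseteq> Y" "C \<subseteq> generate G (e ` F)"
      "finite F'" "F' \<subseteq> Y" "x \<in> generate G (e ` F')" using single[of x] by auto
    then show ?case
      using mono[of F "F \<union> F'"] mono[of F' "F \<union> F'"] by (intro exI[of _ "F \<union> F'"]) auto
  qed
  then show ?thesis using that by blast
qed

lemma countable_generate:
  assumes "countable B"
  shows "countable (generate G B)"
proof -
  define K where "K F = (\<lambda>(x, y). x \<otimes>\<^bsub>G\<^esub> y) ` (F \<times> F)" for F
  let ?C = "insert \<one>\<^bsub>G\<^esub> (B \<union> (\<lambda>b. inv\<^bsub>G\<^esub> b) ` B)"
  obtain D where D: "countable D" "?C \<subseteq> D" "\<And>F. finite F \<Longrightarrow> F \<subseteq> D \<Longrightarrow> K F \<subseteq> D"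
    by (rule countable_closure[of ?C K]) (use assms in \<open>auto simp: K_def intro: countable_finite\<close>)
  have "generate G B \<subseteq> D"
  proof
    fix x assume "x \<in> generate G B"
    then show "x \<in> D"
    proof induction
      case (eng x y)
      then show ?case using D(3)[of "{x, y}"] by (simp add: K_def)
    qed (use D(2) in \<open>simp_all add: image_subset_iff subset_iff\<close>)
  qed
  then show ?thesis by (rule countable_subset[OF _ D(1)])
qed

text \<open>Let \<open>x\<close> involve the basis elements of the finite set \<open>S\<close>. A map \<open>\<sigma>\<close> that is the identity on
  \<open>Y\<close> and sends \<open>S - Y\<close> injectively into \<open>Y - S\<close> induces a retraction \<open>\<phi>\<close>. As \<open>\<sigma>\<close> is injective on \<open>S\<close>, an
  endomorphism \<open>\<psi>\<close> undoes the renaming, so \<open>\<psi> (\<phi> x) = x\<close> and \<open>\<phi> x\<close> is not the identity.\<close>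
lemma (in group) separating_retraction:
  assumes basis: "free_basis G X e" and Y: "Y \<subseteq> X" "Y = X \<or> infinite Y"
    and x: "x \<in> carrier G" "x \<noteq> \<one>"
  shows "\<exists>\<phi>\<in>hom G G. \<phi> ` carrier G \<subseteq> generate G (e ` Y)
    \<and> (\<forall>h\<in>generate G (e ` Y). \<phi> h = h) \<and> \<phi> x \<noteq> \<one>"
proof -
  have e: "e ` X \<subseteq> carrier G" "generate G (e ` X) = carrier G"
    "\<And>f. f ` X \<subseteq> carrier G \<Longrightarrow> \<exists>\<phi>\<in>hom G G. \<forall>x\<in>X. \<phi> (e x) = f x"
    using basis by (simp_all add: free_basis_def)
  have eY: "e ` Y \<subseteq> carrier G" using e(1) Y(1) by blast
  obtain S where S: "finite S" "S \<subseteq> X" "x \<in> generate G (e ` S)"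
    using generate_finitary[of "{x}" e X] x(1) e(2) by auto
  have "\<exists>\<sigma>. inj_on \<sigma> S \<and> \<sigma> ` S \<subseteq> Y \<and> (\<forall>z\<in>S \<inter> Y. \<sigma> z = z)"
  proof (cases "Y = X")
    case True
    then show ?thesis using S(2) by (intro exI[of _ "\<lambda>z. z"]) auto
  next
    case False
    then have "infinite (Y - S)" using Y(2) S(1) by simp
    then obtain B where B: "B \<subseteq> Y - S" "finite B" "card B = card S"
      using infinite_arbitrarily_large by blast
    obtain f where f: "bij_betw f S B" using finite_same_card_bij[OF S(1) B(2)] B(3) by auto
    have fS: "f z \<in> Y - S" if "z \<in> S" for z using f B(1) that by (auto simp: bij_betw_def)
    have "inj_on f S" using f by (simp add: bij_betw_def)
    then have "inj_on (\<lambda>z. if z \<in> Y then z else f z) S"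
      using fS unfolding inj_on_def by (metis DiffD2)
    then show ?thesis using fS by (intro exI[of _ "\<lambda>z. if z \<in> Y then z else f z"]) auto
  qed
  then obtain \<sigma> where \<sigma>: "inj_on \<sigma> S" "\<sigma> ` S \<subseteq> Y" "\<forall>z\<in>S \<inter> Y. \<sigma> z = z" by blast
  define f where "f z = (if z \<in> Y then e z else if z \<in> S then e (\<sigma> z) else \<one>)" for z
  have fY: "f ` X \<subseteq> generate G (e ` Y)"
    using \<sigma>(2) by (auto simp: f_def intro: generate.one generate.incl)
  then have "f ` X \<subseteq> carrier G" using generate_incl[OF eY] by blast
  then obtain \<phi> where \<phi>: "\<phi> \<in> hom G G" "\<forall>z\<in>X. \<phi> (e z) = f z" using e(3) by blast
  define f' where "f' z = (if z \<in> \<sigma> ` S then e (inv_into S \<sigma> z) else \<one>)" for z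
  have "f' ` X \<subseteq> carrier G"
  proof -
    have "inv_into S \<sigma> z \<in> X" if "z \<in> \<sigma> ` S" for z using inv_into_into[OF that] S(2) by blast
    then show ?thesis using e(1) by (auto simp: f'_def)
  qed
  then obtain \<psi> where \<psi>: "\<psi> \<in> hom G G" "\<forall>z\<in>X. \<psi> (e z) = f' z" using e(3) by blast
  interpret \<phi>: group_hom G G \<phi> using \<phi>(1) by unfold_locales
  interpret \<psi>: group_hom G G \<psi> using \<psi>(1) by unfold_locales
  have id: "(\<lambda>z. z) \<in> hom G G" by (simp add: hom_def)
  have "\<phi> ` carrier G \<subseteq> generate G (e ` Y)"
  proof -
    have "\<phi> ` carrier G = generate G (\<phi> ` (e ` X))" using \<phi>.generate_img[OF e(1)] e(2) by simp
    also have "\<phi> ` (e ` X) = f ` X" using \<phi>(2) by (simp add: image_image)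
    also have "generate G (f ` X) \<subseteq> generate G (e ` Y)"
      by (rule generate_subgroup_incl[OF fY generate_is_subgroup[OF eY]])
    finally show ?thesis .
  qed
  moreover have "\<phi> h = h" if h: "h \<in> generate G (e ` Y)" for h
  proof (rule hom_eq_on_generate[OF \<phi>(1) id eY _ h])
    fix b assume "b \<in> e ` Y"
    then show "\<phi> b = b" using \<phi>(2) Y(1) by (auto simp: f_def)
  qed
  moreover have "\<phi> x \<noteq> \<one>"
  proof
    assume "\<phi> x = \<one>"
    have eS: "e ` S \<subseteq> carrier G" using e(1) S(2) by blast
    have \<psi>\<phi>: "(\<psi> \<circ> \<phi>) (e z) = e z" if z: "z \<in> S" for z
    proof -
      have "\<phi> (e z) = e (\<sigma> z)" using \<phi>(2) \<sigma>(3) z S(2) by (auto simp: f_def)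
      moreover have "\<sigma> z \<in> X" using \<sigma>(2) Y(1) z by blast
      ultimately show ?thesis using \<psi>(2) z \<sigma>(1) by (simp add: f'_def inv_into_f_f)
    qed
    have "(\<psi> \<circ> \<phi>) x = x"
    proof (rule hom_eq_on_generate[OF Group.hom_compose[OF \<phi>(1) \<psi>(1)] id eS _ S(3)])
      fix b assume "b \<in> e ` S"
      then show "(\<psi> \<circ> \<phi>) b = b" using \<psi>\<phi> by (elim imageE) simp
    qed
    then show False using \<open>\<phi> x = \<one>\<close> x(2) by simp
  qed
  ultimately show ?thesis using \<phi>(1) by blast
qed

section \<open>Reduction to a countable free factor\<close>

text \<open>A choice function \<open>c\<close> selects a witness in \<open>A\<close> for each finite set of words to which
  adherence applies. The countable set \<open>Y\<close> of basis elements is closed under passing from such a set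
  of words with coefficients in the generated subgroup to the finitely many basis elements that its
  witness involves. A finite set of words has finitely many coefficients, each involving finitely
  many basis elements, so closing off over finite sets of basis elements suffices.\<close>
lemma (in group) countable_adherent_factor:
  assumes basis: "free_basis G X e" and A: "A \<subseteq> carrier G"
    and adherent: "one_adherent G (carrier G) A"
  obtains Y where "Y \<subseteq> X" "Y = X \<or> infinite Y" "countable Y"
    "one_adherent G (generate G (e ` Y)) (A \<inter> generate G (e ` Y))"
proof -
  have e: "e ` X \<subseteq> carrier G" "generate G (e ` X) = carrier G"
    using basis by (simp_all add: free_basis_def)
  have gen: "generate G (e ` F) \<subseteq> carrier G" if "F \<subseteq> X" for F
    using that e(1) by (intro generate_incl) blast
  have "\<forall>x\<in>carrier G. \<exists>F. finite F \<and> F \<subseteq> X \<and> x \<in> generate G (e ` F)"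
  proof
    fix x assume "x \<in> carrier G"
    then obtain F where "finite F" "F \<subseteq> X" "{x} \<subseteq> generate G (e ` F)"
      using generate_finitary[of "{x}" e X] e(2) by auto
    then show "\<exists>F. finite F \<and> F \<subseteq> X \<and> x \<in> generate G (e ` F)" by auto
  qed
  then obtain supp where supp: "\<forall>x\<in>carrier G. finite (supp x) \<and> supp x \<subseteq> X \<and> x \<in> generate G (e ` supp x)"
    by (rule bchoice[THEN exE])
  define good where "good B = {W. finite W \<and> W \<subseteq> word_maps G B \<and> (\<forall>p\<in>W. p \<one> \<noteq> \<one>)}" for B
  have "\<forall>W\<in>good (carrier G). \<exists>a. a \<in> A \<and> (\<forall>p\<in>W. p a \<noteq> \<one>)"
  proof
    fix W assume "W \<in> good (carrier G)"
    then have W: "finite W" "W \<subseteq> word_maps G (carrier G)" "\<forall>p\<in>W. p \<one> \<noteq> \<one>"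
      by (simp_all add: good_def)
    obtain a where "a \<in> A" "\<forall>p\<in>W. p a \<noteq> \<one>" using one_adherentD[OF adherent W] .
    then have "a \<in> A \<and> (\<forall>p\<in>W. p a \<noteq> \<one>)" ..
    then show "\<exists>a. a \<in> A \<and> (\<forall>p\<in>W. p a \<noteq> \<one>)" ..
  qed
  then obtain c where c: "\<forall>W\<in>good (carrier G). c W \<in> A \<and> (\<forall>p\<in>W. p (c W) \<noteq> \<one>)"
    by (rule bchoice[THEN exE])
  have good_mono: "good B \<subseteq> good B'" if "B \<subseteq> B'" for B B'
    using word_maps_mono[OF that, of G] by (auto simp: good_def)
  define K where "K F = (\<Union>W\<in>good (generate G (e ` (F \<inter> X))). supp (c W))" for F
  have K: "countable (K F)" if "finite F" for F
  proof -
    let ?B = "generate G (e ` (F \<inter> X))"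
    have "countable (word_maps G ?B)"
      using that by (intro countable_word_maps countable_generate countable_finite) simp
    then have "countable {W. finite W \<and> W \<subseteq> word_maps G ?B}"
      by (rule countable_Collect_finite_subset)
    then have "countable (good ?B)"
      by (rule countable_subset[rotated]) (auto simp: good_def)
    moreover have "finite (supp (c W))" if "W \<in> good ?B" for W
    proof -
      have "W \<in> good (carrier G)" using good_mono[OF gen[of "F \<inter> X"]] that by blast
      then have "c W \<in> carrier G" using c A by blast
      then show ?thesis using supp by blast
    qed
    ultimately show ?thesis by (auto simp: K_def intro: countable_finite)
  qed
  \<comment> \<open>Starting from an infinite set (if there is one) leaves room in \<open>Y\<close> for renaming basis
    elements.\<close>
  have "\<exists>Y0. Y0 \<subseteq> X \<and> countable Y0 \<and> (Y0 = X \<or> infinite Y0)"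
  proof (cases "finite X")
    case False
    then show ?thesis using infinite_countable_subset'[of X] by blast
  qed (auto intro: countable_finite)
  then obtain Y0 where Y0: "Y0 \<subseteq> X" "countable Y0" "Y0 = X \<or> infinite Y0" by blast
  obtain D where D: "countable D" "Y0 \<subseteq> D" "\<And>F. finite F \<Longrightarrow> F \<subseteq> D \<Longrightarrow> K F \<subseteq> D"
    by (rule countable_closure[of Y0 K]) (use Y0(2) K in auto)
  define Y where "Y = D \<inter> X"
  show ?thesis
  proof (rule that[of Y])
    show "Y \<subseteq> X" by (simp add: Y_def)
    show "countable Y" using D(1) by (simp add: Y_def)
    have "Y0 \<subseteq> Y" using Y0(1) D(2) by (simp add: Y_def)
    then show "Y = X \<or> infinite Y" using Y0(3) \<open>Y \<subseteq> X\<close> finite_subset[of Y0 Y] by blast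
    show "one_adherent G (generate G (e ` Y)) (A \<inter> generate G (e ` Y))"
      unfolding one_adherent_def
    proof (intro allI impI)
      fix W assume W: "finite W" "W \<subseteq> word_maps G (generate G (e ` Y))" "\<forall>p\<in>W. p \<one> \<noteq> \<one>"
      obtain C where C: "finite C" "C \<subseteq> generate G (e ` Y)" "W \<subseteq> word_maps G C"
        using word_maps_finitary[OF W(1,2)] .
      obtain F where F: "finite F" "F \<subseteq> Y" "C \<subseteq> generate G (e ` F)"
        using generate_finitary[OF C(1,2)] .
      have "W \<in> good C" using W C(3) by (simp add: good_def)
      then have WF: "W \<in> good (generate G (e ` F))" using good_mono[OF F(3)] by blast
      then have WG: "W \<in> good (carrier G)" using good_mono[OF gen[of F]] F(2) by (auto simp: Y_def)
      have "F \<inter> X = F" using F(2) by (auto simp: Y_def)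
      then have "supp (c W) \<subseteq> K F" using WF by (auto simp: K_def)
      also have "K F \<subseteq> D" using D(3) F(1,2) by (simp add: Y_def)
      finally have "supp (c W) \<subseteq> D" .
      moreover have cW: "c W \<in> A" "\<forall>p\<in>W. p (c W) \<noteq> \<one>" using c WG by auto
      ultimately have "supp (c W) \<subseteq> Y" "c W \<in> generate G (e ` supp (c W))"
        using supp A by (auto simp: Y_def)
      then have "c W \<in> generate G (e ` Y)" using mono_generate[of "e ` supp (c W)" "e ` Y"] by blast
      then show "\<exists>a\<in>A \<inter> generate G (e ` Y). \<forall>p\<in>W. p a \<noteq> \<one>"
        using cW by (intro bexI[of _ "c W"] IntI)
    qed
  qed
qed

section \<open>Unconditionally closed sets in free groups are algebraic\<close>

lemma openin_zariski_nonvanishing: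
  assumes "group G" "finite W" "W \<subseteq> word_maps G (carrier G)"
  shows "openin (zariski_topology G) {g \<in> carrier G. \<forall>p\<in>W. p g \<noteq> \<one>\<^bsub>G\<^esub>}"
  using assms(2,3)
proof induction
  case empty
  show ?case using openin_topspace[of "zariski_topology G"] by (simp add: topspace_zariski_topology)
next
  case (insert p W)
  then obtain w where w: "w \<in> carrier (adjoin_var G)" "\<forall>g\<in>carrier G. ev G g w = p g"
    using word_map_is_evaluation[OF assms(1), of p] by auto
  have "openin (zariski_topology G) (carrier G - solution_set G w)"
    using closedin_zariski_solution_set[OF w(1)] by (simp add: closedin_def topspace_zariski_topology)
  moreover have "carrier G - solution_set G w = {g \<in> carrier G. p g \<noteq> \<one>\<^bsub>G\<^esub>}"
    using w(2) by (auto simp: solution_set_def)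
  moreover have "openin (zariski_topology G) {g \<in> carrier G. \<forall>p\<in>W. p g \<noteq> \<one>\<^bsub>G\<^esub>}"
    using insert by simp
  ultimately have "openin (zariski_topology G)
      ({g \<in> carrier G. p g \<noteq> \<one>\<^bsub>G\<^esub>} \<inter> {g \<in> carrier G. \<forall>p\<in>W. p g \<noteq> \<one>\<^bsub>G\<^esub>})"
    by (simp add: openin_Int)
  moreover have "{g \<in> carrier G. p g \<noteq> \<one>\<^bsub>G\<^esub>} \<inter> {g \<in> carrier G. \<forall>p\<in>W. p g \<noteq> \<one>\<^bsub>G\<^esub>}
      = {g \<in> carrier G. \<forall>p\<in>insert p W. p g \<noteq> \<one>\<^bsub>G\<^esub>}" by auto
  ultimately show ?case by simp
qed

lemma (in group) word_maps_translate:
  assumes "p \<in> word_maps G C" "c \<in> C"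
  shows "(\<lambda>t. p (c \<otimes> t)) \<in> word_maps G C"
  using assms(1)
proof induction
  case (const d)
  then show ?case by (rule word_maps.const)
next
  case var
  show ?case by (intro word_maps.mult word_maps.const word_maps.var assms(2))
next
  case (mult p q)
  then show ?case by (intro word_maps.mult)
next
  case (inv p)
  then show ?case by (intro word_maps.inv)
qed

text \<open>A point \<open>b\<close> of the Zariski closure outside \<open>A\<close> is moved to the identity by replacing \<open>A\<close> with
  \<open>A' = b\<inverse> A\<close>. The topology constructed for \<open>A'\<close> then has \<open>b\<close> in the closure of \<open>A\<close>.\<close>
lemma (in group) unconditionally_closed_imp_algebraic:
  assumes basis: "free_basis G X e" and A: "unconditionally_closed G A"
  shows "algebraic_subset G A"
proof (rule ccontr)
  assume nonalg: "\<not> algebraic_subset G A"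
  have AG: "A \<subseteq> carrier G" using A by (simp add: unconditionally_closed_def)
  then have "\<not> openin (zariski_topology G) (carrier G - A)"
    using nonalg by (simp add: algebraic_subset_def closedin_def topspace_zariski_topology)
  then have "\<exists>b\<in>carrier G - A. \<forall>S. openin (zariski_topology G) S \<and> b \<in> S \<longrightarrow> \<not> S \<subseteq> carrier G - A"
    by (subst (asm) openin_subopen) blast
  then obtain b where b: "b \<in> carrier G" "b \<notin> A"
    and near: "\<forall>S. openin (zariski_topology G) S \<and> b \<in> S \<longrightarrow> \<not> S \<subseteq> carrier G - A"
    by blast
  define A' where "A' = (\<lambda>a. inv b \<otimes> a) ` A"
  have A'G: "A' \<subseteq> carrier G" using AG b(1) by (auto simp: A'_def)
  have adherent: "one_adherent G (carrier G) A'"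
    unfolding one_adherent_def
  proof (intro allI impI)
    fix W assume W: "finite W" "W \<subseteq> word_maps G (carrier G)" "\<forall>p\<in>W. p \<one> \<noteq> \<one>"
    let ?W = "(\<lambda>p t. p (inv b \<otimes> t)) ` W"
    let ?S = "{g \<in> carrier G. \<forall>p\<in>?W. p g \<noteq> \<one>}"
    have "?W \<subseteq> word_maps G (carrier G)"
    proof (rule image_subsetI)
      fix p assume "p \<in> W"
      then have "p \<in> word_maps G (carrier G)" using W(2) by blast
      then show "(\<lambda>t. p (inv b \<otimes> t)) \<in> word_maps G (carrier G)"
        by (rule word_maps_translate) (use b(1) in simp)
    qed
    then have "openin (zariski_topology G) ?S"
      using W(1) by (intro openin_zariski_nonvanishing[OF is_group]) simp_all
    moreover have "b \<in> ?S" using W(3) b(1) by simp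
    ultimately have "\<not> ?S \<subseteq> carrier G - A" using near by blast
    then obtain a where "a \<in> ?S" "a \<in> A" by blast
    then have "inv b \<otimes> a \<in> A'" "\<forall>p\<in>W. p (inv b \<otimes> a) \<noteq> \<one>" by (simp_all add: A'_def)
    then show "\<exists>a\<in>A'. \<forall>p\<in>W. p a \<noteq> \<one>" by (intro bexI[of _ "inv b \<otimes> a"])
  qed
  obtain Y where Y: "Y \<subseteq> X" "Y = X \<or> infinite Y" "countable Y"
    "one_adherent G (generate G (e ` Y)) (A' \<inter> generate G (e ` Y))"
    using countable_adherent_factor[OF basis A'G adherent] .
  let ?H = "generate G (e ` Y)"
  have eY: "e ` Y \<subseteq> carrier G" using basis Y(1) by (auto simp: free_basis_def)
  have "countable ?H" using Y(3) by (intro countable_generate countable_image)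
  then obtain T where T: "hausdorff_group_topology G T"
    "\<And>S b. openin T S \<Longrightarrow> b \<in> S \<Longrightarrow> \<exists>a\<in>A' \<inter> ?H. b \<otimes> a \<in> S"
    using topology_with_adherent_set[OF generate_is_subgroup[OF eY] _ Int_lower2
        separating_retraction[OF basis Y(1,2)] Y(4)] by blast
  have "closedin T A" using A T(1) by (simp add: unconditionally_closed_def)
  then have "openin T (carrier G - A)"
    using T(1) by (simp add: closedin_def hausdorff_group_topology_def)
  then obtain a where "a \<in> A'" "b \<otimes> a \<in> carrier G - A" using T(2)[of "carrier G - A" b] b(1,2) by blast
  then obtain a' where "a' \<in> A" "b \<otimes> (inv b \<otimes> a') \<notin> A" by (auto simp: A'_def)
  then show False using AG b(1) by (auto simp: m_assoc[symmetric])
qed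

theorem theorem1p3:
  fixes G :: "('a, 'c) monoid_scheme" and X :: "'x set"
  assumes "group G" and "free_group X \<cong> G"
  shows "(\<forall>A. unconditionally_closed G A \<longrightarrow> algebraic_subset G A)
    \<and> markov_topology G = zariski_topology G"
proof
  interpret group G by fact
  obtain e where basis: "free_basis G X e" using iso_free_group_has_basis[OF assms] by blast
  show alg: "\<forall>A. unconditionally_closed G A \<longrightarrow> algebraic_subset G A"
    using unconditionally_closed_imp_algebraic[OF basis] by blast
  have "algebraic_subset G A \<Longrightarrow> unconditionally_closed G A" for A
  proof -
    assume A: "algebraic_subset G A"
    then have AG: "A \<subseteq> carrier G"
      using closedin_subset[of "zariski_topology G" A]
      by (simp add: algebraic_subset_def topspace_zariski_topology)
    have "closedin T A" if T: "hausdorff_group_topology G T" for T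
    proof -
      have top: "topspace T = carrier G" using T by (simp add: hausdorff_group_topology_def)
      have "openin (zariski_topology G) (carrier G - A)"
        using A by (simp add: algebraic_subset_def closedin_def topspace_zariski_topology)
      then have "openin T (carrier G - A)"
        using zariski_topology_coarsest[OF top] solution_set_closed[OF assms(1) T] by blast
      then show ?thesis using AG top by (simp add: closedin_def)
    qed
    then show "unconditionally_closed G A" using AG by (simp add: unconditionally_closed_def)
  qed
  then have "closedin (markov_topology G) A \<longleftrightarrow> closedin (zariski_topology G) A" for A
    using alg by (auto simp: closedin_markov_topology algebraic_subset_def)
  then show "markov_topology G = zariski_topology G"
    by (simp add: topology_eq openin_closedin_eq topspace_markov_topology topspace_zariski_topology)
qed

end
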